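(* Let $\chi(n)$ be the maximum, over all invertible $n\times n$ matrices $A$ with entries in $\{0,1\}$, of the largest absolute value of an entry of $A^{-1}$, and let $\rho_m$ be the maximum of $|\det B|$ over $m\times m$ matrices $B$ with entries in $\{0,1\}$. Then there is a function $g(n)=o(n)$ such that for all $n\ge2$ $$\frac{n^{n/2}}{2^{2n+g(n)}}\le\chi(n)\le\rho_{n-1}\le\frac{n^{n/2}}{2^{n-1}}.$$ *)

theory Defs
  imports Complex_Main "Jordan_Normal_Form.Matrix" "Jordan_Normal_Form.Determinant"
    "HOL-Library.Landau_Symbols"
begin

definition zero_one_mat :: "nat \<Rightarrow> real mat \<Rightarrow> bool" where
  "zero_one_mat n A \<longleftrightarrow> A \<in> carrier_mat n n \<and> (\<forall>i<n. \<forall>j<n. A $$ (i,j) \<in> {0,1})"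

definition chi :: "nat \<Rightarrow> real" where
  "chi n = Max {\<bar>B $$ (i,j)\<bar> | A B i j. zero_one_mat n A \<and> invertible_mat A \<and>
      B \<in> carrier_mat n n \<and> inverts_mat A B \<and> inverts_mat B A \<and> i < n \<and> j < n}"

definition rho :: "nat \<Rightarrow> real" where
  "rho m = Max {\<bar>det B\<bar> | B. zero_one_mat m B}"

end

theory Submission
  imports Defs
begin

text \<open>
  Upper bounds: an entry of the inverse is a cofactor divided by a nonzero integer determinant, and
  bordering a 0-1 matrix \<open>B\<close> of order \<open>n - 1\<close> gives a sign matrix of order \<open>n\<close> with
  determinant \<open>\<plusminus>2^(n-1) det B\<close>, to which Hadamard's inequality applies.

  Lower bound (following Hastad, Alon and Vu): list the subsets of an \<open>m\<close>-set as
  \<open>\<alpha> 0, \<alpha> 1, \<dots>\<close> by increasing size so that consecutive sets differ by adding one element or by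
  exchanging two. Let \<open>Q\<close> be the Walsh-Hadamard matrix in this order. Flipping the
  sign of the character of \<open>\<alpha> (i - 1)\<close> outside a small affine subspace gives a sign vector whose Fourier
  expansion only involves sets up to \<open>\<alpha> i\<close>, with coefficient about \<open>-1\<close> at \<open>\<alpha> (i - 1)\<close> and
  the tiny coefficient \<open>2^(1 - card (\<alpha> i))\<close> at \<open>\<alpha> i\<close>. These vectors, turned into 0-1 vectors, are the
  rows of \<open>L Q\<close> for a lower triangular \<open>L\<close>; forward substitution in \<open>L\<close> multiplies by about
  \<open>2^(card (\<alpha> i) - 1)\<close> in step \<open>i\<close>, which produces an inverse entry of size
  \<open>N^(N/2) / 2^(N + o(N))\<close> for \<open>N = 2^m\<close>. Linking two matrices by a single off-diagonal 1 multiplies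
  inverse entries, so the binary expansion of \<open>n\<close> reduces the general case to powers of two, at the
  cost of a further factor of at most \<open>2^n\<close>.
\<close>

subsection \<open>Hadamard's inequality\<close>

text \<open>The Gram matrix of the rows, entry by entry.\<close>

definition dot :: "nat \<Rightarrow> real mat \<Rightarrow> nat \<Rightarrow> nat \<Rightarrow> real" where
  "dot n A i j = (\<Sum>l<n. A $$ (i,l) * A $$ (j,l))"

lemma dot_commute: "dot n A i j = dot n A j i"
  unfolding dot_def by (simp add: mult.commute)

lemma dot_self_nonneg: "0 \<le> dot n A i i"
  unfolding dot_def by (intro sum_nonneg) auto

lemma dot_self_eq_0:
  assumes "dot n A i i = 0"
  shows "dot n A i j = 0"
proof -
  have "\<forall>l\<in>{..<n}. A $$ (i,l) * A $$ (i,l) = 0"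
    using assms unfolding dot_def by (subst (asm) sum_nonneg_eq_0_iff) auto
  thus ?thesis unfolding dot_def by (intro sum.neutral) auto
qed

text \<open>One Gram-Schmidt step without normalisation: row \<open>k\<close> loses its projection
  onto the earlier rows. The operation is left multiplication by a unit lower triangular matrix, so
  the determinant stays, and a projection never lengthens a row.\<close>

lemma orthogonalise_row:
  fixes A :: "real mat"
  assumes A: "A \<in> carrier_mat n n" and k: "k < n"
    and orth: "\<And>i j. i < k \<Longrightarrow> j < k \<Longrightarrow> i \<noteq> j \<Longrightarrow> dot n A i j = 0"
  obtains A' where "A' \<in> carrier_mat n n" "det A' = det A"
    "\<And>i. i < n \<Longrightarrow> dot n A' i i \<le> dot n A i i"
    "\<And>i j. i < Suc k \<Longrightarrow> j < Suc k \<Longrightarrow> i \<noteq> j \<Longrightarrow> dot n A' i j = 0"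
proof -
  \<comment> \<open>If row \<open>j\<close> is zero, division by zero makes \<open>c j\<close> equal
    to 0; by \<open>dot_self_eq_0\<close> all inner products with that row vanish too, so the
    projection formula still holds.\<close>
  define c where "c j = dot n A k j / dot n A j j" for j
  define T where "T = mat n n (\<lambda>(i,j). if i = j then 1 else if i = k \<and> j < k then - c j else 0)"
  have T: "T \<in> carrier_mat n n" by (simp add: T_def)
  have dT: "det T = 1"
  proof -
    have "det T = prod_list (diag_mat T)"
      by (rule det_lower_triangular[OF _ T]) (auto simp: T_def)
    also have "\<dots> = 1" unfolding prod_list_diag_prod by (auto simp: T_def intro!: prod.neutral)
    finally show ?thesis .
  qed
  have TA: "T * A \<in> carrier_mat n n" using T A by simp
  have row_other: "(T * A) $$ (i,l) = A $$ (i,l)" if "i < n" "l < n" "i \<noteq> k" for i l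
  proof -
    have "(T * A) $$ (i,l) = (\<Sum>j<n. T $$ (i,j) * A $$ (j,l))"
      using that T A by (simp add: scalar_prod_def atLeast0LessThan)
    also have "\<dots> = (\<Sum>j<n. if j = i then A $$ (j,l) else 0)"
      using that by (intro sum.cong) (auto simp: T_def)
    also have "\<dots> = A $$ (i,l)" using that by simp
    finally show ?thesis .
  qed
  have row_k: "(T * A) $$ (k,l) = A $$ (k,l) - (\<Sum>j<k. c j * A $$ (j,l))" if "l < n" for l
  proof -
    have "(T * A) $$ (k,l) = (\<Sum>j<n. T $$ (k,j) * A $$ (j,l))"
      using that T A k by (simp add: scalar_prod_def atLeast0LessThan)
    also have "\<dots> = (\<Sum>j<n. (if j = k then A $$ (j,l) else 0) + (if j < k then - c j * A $$ (j,l) else 0))"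
      using that k by (intro sum.cong) (auto simp: T_def)
    also have "\<dots> = A $$ (k,l) + (\<Sum>j<n. if j < k then - c j * A $$ (j,l) else 0)"
      using k by (simp add: sum.distrib)
    also have "(\<Sum>j<n. if j < k then - c j * A $$ (j,l) else 0) = (\<Sum>j<k. - c j * A $$ (j,l))"
      using k by (intro sum.mono_neutral_cong_right) auto
    finally show ?thesis by (simp add: sum_negf)
  qed
  have dot_k: "dot n (T * A) k i = dot n A k i - (\<Sum>j<k. c j * dot n A j i)"
    if i: "i < n" "i \<noteq> k" for i
  proof -
    have "dot n (T * A) k i = (\<Sum>l<n. A $$ (k,l) * A $$ (i,l) - (\<Sum>j<k. c j * (A $$ (j,l) * A $$ (i,l))))"
      unfolding dot_def using i
      by (intro sum.cong) (auto simp: row_k row_other algebra_simps sum_distrib_left)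
    also have "\<dots> = dot n A k i - (\<Sum>l<n. \<Sum>j<k. c j * (A $$ (j,l) * A $$ (i,l)))"
      by (simp add: sum_subtractf dot_def)
    also have "(\<Sum>l<n. \<Sum>j<k. c j * (A $$ (j,l) * A $$ (i,l))) = (\<Sum>j<k. c j * dot n A j i)"
      unfolding dot_def sum_distrib_left by (rule sum.swap)
    finally show ?thesis .
  qed
  have orth_k: "dot n (T * A) k i = 0" if i: "i < k" for i
  proof -
    have "(\<Sum>j<k. c j * dot n A j i) = (\<Sum>j<k. if j = i then c i * dot n A i i else 0)"
      using orth i by (intro sum.cong) auto
    also have "\<dots> = c i * dot n A i i" using i by simp
    also have "\<dots> = dot n A k i"
      using dot_self_eq_0[of n A i k] by (auto simp: c_def dot_commute)
    finally show ?thesis using dot_k[of i] i k by simp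
  qed
  \<comment> \<open>Pythagoras: the old row \<open>k\<close> is the new one plus the projection
    \<open>?P\<close>, and these two are orthogonal.\<close>
  have norm_k: "dot n (T * A) k k \<le> dot n A k k"
  proof -
    have eq: "A $$ (k,l) = (T * A) $$ (k,l) + (\<Sum>j<k. c j * A $$ (j,l))" if "l < n" for l
      using row_k[OF that] by simp
    let ?P = "\<lambda>l. \<Sum>j<k. c j * A $$ (j,l)"
    have cross: "(\<Sum>l<n. (T * A) $$ (k,l) * ?P l) = 0"
    proof -
      have "(\<Sum>l<n. (T * A) $$ (k,l) * ?P l) = (\<Sum>l<n. \<Sum>j<k. c j * ((T * A) $$ (k,l) * (T * A) $$ (j,l)))"
        using k by (intro sum.cong refl) (auto simp: sum_distrib_left row_other intro!: sum.cong)
      also have "\<dots> = (\<Sum>j<k. c j * dot n (T * A) k j)"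
        unfolding dot_def sum_distrib_left by (rule sum.swap)
      also have "\<dots> = 0" by (simp add: orth_k)
      finally show ?thesis .
    qed
    have "dot n A k k = (\<Sum>l<n. ((T * A) $$ (k,l) + ?P l) * ((T * A) $$ (k,l) + ?P l))"
      unfolding dot_def by (intro sum.cong refl arg_cong2[of _ _ _ _ "(*)"] eq) auto
    also have "\<dots> = (\<Sum>l<n. (T * A) $$ (k,l) * (T * A) $$ (k,l) + ?P l * ?P l + 2 * ((T * A) $$ (k,l) * ?P l))"
      by (intro sum.cong refl) (simp only: algebra_simps mult_2)
    also have "\<dots> = dot n (T * A) k k + (\<Sum>l<n. ?P l * ?P l)"
      unfolding sum.distrib sum_distrib_left[symmetric] cross dot_def by simp
    finally show ?thesis using sum_nonneg[of "{..<n}" "\<lambda>l. ?P l * ?P l"] by auto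
  qed
  have dot_other: "dot n (T * A) i j = dot n A i j" if "i < n" "j < n" "i \<noteq> k" "j \<noteq> k" for i j
    unfolding dot_def using that by (intro sum.cong) (auto simp: row_other)
  show ?thesis
  proof (rule that[OF TA])
    show "det (T * A) = det A" using det_mult[OF T A] dT by simp
    show "dot n (T * A) i i \<le> dot n A i i" if "i < n" for i
      using norm_k dot_other[of i i] that by (cases "i = k") auto
    show "dot n (T * A) i j = 0" if "i < Suc k" "j < Suc k" "i \<noteq> j" for i j
    proof (cases "i = k \<or> j = k")
      case True
      thus ?thesis using that orth_k[of j] orth_k[of i] by (auto simp: less_Suc_eq dot_commute)
    next
      case False
      thus ?thesis using that orth[of i j] dot_other[of i j] k by auto
    qed
  qed
qed

lemma orthogonalise_rows:
  fixes A :: "real mat"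
  assumes A: "A \<in> carrier_mat n n" and "k \<le> n"
  shows "\<exists>A'. A' \<in> carrier_mat n n \<and> det A' = det A \<and> (\<forall>i<n. dot n A' i i \<le> dot n A i i) \<and>
    (\<forall>i<k. \<forall>j<k. i \<noteq> j \<longrightarrow> dot n A' i j = 0)"
  using \<open>k \<le> n\<close>
proof (induction k)
  case 0
  thus ?case using A by auto
next
  case (Suc k)
  then obtain B where B: "B \<in> carrier_mat n n" "det B = det A" "\<forall>i<n. dot n B i i \<le> dot n A i i"
    "\<And>i j. i < k \<Longrightarrow> j < k \<Longrightarrow> i \<noteq> j \<Longrightarrow> dot n B i j = 0" by auto
  obtain A' where A': "A' \<in> carrier_mat n n" "det A' = det B"
    "\<And>i. i < n \<Longrightarrow> dot n A' i i \<le> dot n B i i"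
    "\<And>i j. i < Suc k \<Longrightarrow> j < Suc k \<Longrightarrow> i \<noteq> j \<Longrightarrow> dot n A' i j = 0"
    using orthogonalise_row[of B n k thesis] B(1,4) Suc.prems Suc_le_lessD by blast
  have "\<forall>i<n. dot n A' i i \<le> dot n A i i" using A'(3) B(3) by (meson order_trans)
  thus ?case using A' B(2) by (intro exI[of _ A']) auto
qed

text \<open>After full orthogonalisation the Gram matrix is diagonal, so its determinant, the square
  of \<open>det A\<close>, is a product of squared row norms that did not grow.\<close>

lemma hadamard_inequality:
  fixes A :: "real mat"
  assumes A: "A \<in> carrier_mat n n"
  shows "(det A)\<^sup>2 \<le> (\<Prod>i<n. dot n A i i)"
proof -
  obtain B where B: "B \<in> carrier_mat n n" "det B = det A" "\<forall>i<n. dot n B i i \<le> dot n A i i"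
    "\<And>i j. i < n \<Longrightarrow> j < n \<Longrightarrow> i \<noteq> j \<Longrightarrow> dot n B i j = 0"
    using orthogonalise_rows[OF A order_refl] by auto
  have BT: "B * transpose_mat B \<in> carrier_mat n n" using B by simp
  have ent: "(B * transpose_mat B) $$ (i,j) = dot n B i j" if "i < n" "j < n" for i j
    using that B(1) by (simp add: scalar_prod_def dot_def atLeast0LessThan)
  have "(det A)\<^sup>2 = det (B * transpose_mat B)"
    using det_mult[OF B(1), of "transpose_mat B"] det_transpose[OF B(1)] B
    by (simp add: power2_eq_square)
  also have "\<dots> = prod_list (diag_mat (B * transpose_mat B))"
    by (rule det_lower_triangular[OF _ BT]) (simp add: ent B(4))
  also have "\<dots> = (\<Prod>i<n. dot n B i i)"
    unfolding prod_list_diag_prod using BT B(1) ent by (auto simp: atLeast0LessThan intro!: prod.cong)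
  also have "\<dots> \<le> (\<Prod>i<n. dot n A i i)"
    using B(3) by (intro prod_mono) (auto simp: dot_self_nonneg)
  finally show ?thesis .
qed

subsection \<open>Upper bounds\<close>

text \<open>Makes the \<open>Max\<close> in \<open>rho\<close> and \<open>chi\<close> a genuine
  maximum: each such matrix is the indicator of a set of index pairs.\<close>

lemma finite_zero_one_mats: "finite {A. zero_one_mat n A}"
proof -
  have "{A. zero_one_mat n A} \<subseteq> (\<lambda>S. mat n n (\<lambda>p. if p \<in> S then 1 else 0)) ` Pow ({..<n} \<times> {..<n})"
  proof
    fix A assume "A \<in> {A. zero_one_mat n A}"
    hence A: "A \<in> carrier_mat n n" "\<And>i j. i < n \<Longrightarrow> j < n \<Longrightarrow> A $$ (i,j) \<in> {0,1}"
      by (auto simp: zero_one_mat_def)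
    let ?S = "{(i,j). i < n \<and> j < n \<and> A $$ (i,j) = 1}"
    have "A = mat n n (\<lambda>p. if p \<in> ?S then 1 else 0)"
      using A by (intro eq_matI) auto
    thus "A \<in> (\<lambda>S. mat n n (\<lambda>p. if p \<in> S then 1 else 0)) ` Pow ({..<n} \<times> {..<n})"
      by (rule image_eqI) auto
  qed
  thus ?thesis by (rule finite_subset) auto
qed

lemma det_zero_one_mat_int:
  assumes "zero_one_mat n A"
  shows "det A \<in> \<int>"
proof -
  have "A $$ (i,j) \<in> \<int>" if "i < n" "j < n" for i j
    using assms that by (force simp: zero_one_mat_def)
  moreover have "A \<in> carrier_mat n n" using assms by (simp add: zero_one_mat_def)
  ultimately show ?thesis
    using permutes_in_image by (fastforce simp: det_def' intro!: Ints_sum Ints_mult Ints_prod)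
qed

lemma zero_one_mat_delete:
  assumes "zero_one_mat n A" "i < n" "j < n"
  shows "zero_one_mat (n - 1) (mat_delete A i j)"
proof -
  have "mat_delete A i j $$ (k,l) \<in> {0,1}" if "k < n - 1" "l < n - 1" for k l
  proof -
    have "mat_delete A i j $$ (k,l) = A $$ (if k < i then k else Suc k, if l < j then l else Suc l)"
      using assms that by (auto simp: mat_delete_def zero_one_mat_def)
    moreover have "(if k < i then k else Suc k) < n" "(if l < j then l else Suc l) < n"
      using that by auto
    ultimately show ?thesis using assms(1) unfolding zero_one_mat_def by metis
  qed
  thus ?thesis using assms mat_delete_carrier by (auto simp: zero_one_mat_def)
qed

lemma abs_det_le_rho:
  assumes "zero_one_mat m B"
  shows "\<bar>det B\<bar> \<le> rho m"
proof -
  have "{\<bar>det B\<bar> | B. zero_one_mat m B} = (\<lambda>B. \<bar>det B\<bar>) ` {B. zero_one_mat m B}" by auto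
  thus ?thesis unfolding rho_def using assms finite_zero_one_mats[of m] by (intro Max_ge) auto
qed

text \<open>Cramer's rule: multiplying the scalar matrix \<open>A * adj_mat A\<close> by
  \<open>B\<close> from the left shows that \<open>adj_mat A\<close> is \<open>det A\<close> times
  \<open>B\<close>.\<close>

lemma inverse_entry_eq_cofactor:
  fixes A :: "real mat"
  assumes A: "A \<in> carrier_mat n n" and B: "B \<in> carrier_mat n n" and BA: "B * A = 1\<^sub>m n"
    and ij: "i < n" "j < n"
  shows "det A * B $$ (i,j) = cofactor A j i" and "det A \<noteq> 0"
proof -
  have "B * (A * adj_mat A) = adj_mat A"
    using assoc_mult_mat[OF B A adj_mat(1)[OF A]] BA left_mult_one_mat[OF adj_mat(1)[OF A]] by simp
  hence "det A \<cdot>\<^sub>m B = adj_mat A"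
    using adj_mat(2)[OF A] B by (simp add: mult_smult_distrib[OF B one_carrier_mat])
  hence "(det A \<cdot>\<^sub>m B) $$ (i,j) = adj_mat A $$ (i,j)" by simp
  thus "det A * B $$ (i,j) = cofactor A j i" using ij A B by (simp add: adj_mat_def)
  show "det A \<noteq> 0" using det_mult[OF B A] BA by auto
qed

lemma inverse_entry_le_rho:
  assumes A: "zero_one_mat n A" and B: "B \<in> carrier_mat n n" and BA: "inverts_mat B A"
    and ij: "i < n" "j < n"
  shows "\<bar>B $$ (i,j)\<bar> \<le> rho (n - 1)"
proof -
  have Ac: "A \<in> carrier_mat n n" using A by (simp add: zero_one_mat_def)
  have BA1: "B * A = 1\<^sub>m n" using BA B by (simp add: inverts_mat_def)
  note * = inverse_entry_eq_cofactor[OF Ac B BA1 ij]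
  \<comment> \<open>A nonzero integer has absolute value at least 1, so dividing the cofactor by
    \<open>det A\<close> cannot enlarge it.\<close>
  have "1 \<le> \<bar>det A\<bar>" using Ints_nonzero_abs_ge1[OF det_zero_one_mat_int[OF A] *(2)] .
  hence "\<bar>B $$ (i,j)\<bar> \<le> \<bar>det A\<bar> * \<bar>B $$ (i,j)\<bar>" by (simp add: mult_le_cancel_right1)
  also have "\<dots> = \<bar>cofactor A j i\<bar>" unfolding *(1)[symmetric] by (simp add: abs_mult)
  also have "\<dots> = \<bar>det (mat_delete A j i)\<bar>" by (simp add: cofactor_def abs_mult power_abs)
  also have "\<dots> \<le> rho (n - 1)" by (intro abs_det_le_rho zero_one_mat_delete A ij)
  finally show ?thesis .
qed

abbreviation inverse_entries :: "nat \<Rightarrow> real set" where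
  "inverse_entries n \<equiv> {\<bar>B $$ (i,j)\<bar> | A B i j. zero_one_mat n A \<and> invertible_mat A \<and>
      B \<in> carrier_mat n n \<and> inverts_mat A B \<and> inverts_mat B A \<and> i < n \<and> j < n}"

text \<open>By Cramer's rule an entry is determined by \<open>A\<close> and its position, which
  leaves finitely many choices.\<close>

lemma finite_inverse_entries: "finite (inverse_entries n)"
proof -
  have "inverse_entries n \<subseteq> (\<lambda>(A,i,j). \<bar>cofactor A j i / det A\<bar>) ` ({A. zero_one_mat n A} \<times> {..<n} \<times> {..<n})"
  proof
    fix x assume "x \<in> inverse_entries n"
    then obtain A B i j where *: "x = \<bar>B $$ (i,j)\<bar>" "zero_one_mat n A"
      "B \<in> carrier_mat n n" "inverts_mat B A" "i < n" "j < n" by auto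
    have Ac: "A \<in> carrier_mat n n" using * by (simp add: zero_one_mat_def)
    have BA: "B * A = 1\<^sub>m n" using * by (simp add: inverts_mat_def)
    have "x = \<bar>cofactor A j i / det A\<bar>"
      unfolding *(1) using inverse_entry_eq_cofactor[OF Ac *(3) BA *(5,6)]
      by (metis nonzero_mult_div_cancel_left)
    thus "x \<in> (\<lambda>(A,i,j). \<bar>cofactor A j i / det A\<bar>) ` ({A. zero_one_mat n A} \<times> {..<n} \<times> {..<n})"
      using * by (intro image_eqI[of _ _ "(A,i,j)"]) auto
  qed
  thus ?thesis by (rule finite_subset) (use finite_zero_one_mats[of n] in auto)
qed

lemma inverts_one_mat: "inverts_mat (1\<^sub>m n) (1\<^sub>m n :: real mat)"
  by (simp add: inverts_mat_def)

lemma chi_le_rho: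
  assumes "n \<ge> 1"
  shows "chi n \<le> rho (n - 1)"
proof -
  have "zero_one_mat n (1\<^sub>m n)" by (auto simp: zero_one_mat_def)
  moreover have "invertible_mat (1\<^sub>m n :: real mat)"
    unfolding invertible_mat_def using inverts_one_mat by auto
  ultimately have "\<bar>(1\<^sub>m n :: real mat) $$ (0,0)\<bar> \<in> inverse_entries n"
    using inverts_one_mat[of n] assms
    by (intro CollectI exI[of _ "1\<^sub>m n"] exI[of _ "0::nat"]) auto
  hence "inverse_entries n \<noteq> {}" by blast
  thus ?thesis unfolding chi_def
    using finite_inverse_entries inverse_entry_le_rho by (intro Max.boundedI) auto
qed

lemma rho_le:
  assumes "n \<ge> 1"
  shows "rho (n - 1) \<le> real n powr (real n / 2) / 2 ^ (n - 1)"
proof -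
  obtain m where n: "n = Suc m" using assms by (cases n) auto
  have "\<bar>det B\<bar> \<le> real n powr (real n / 2) / 2 ^ m" if zB: "zero_one_mat m B" for B
  proof -
    have B: "B \<in> carrier_mat m m" using zB by (simp add: zero_one_mat_def)
    define o1 where "o1 = mat 1 m (\<lambda>_. 1 :: real)"
    define o2 where "o2 = mat m 1 (\<lambda>_. 1 :: real)"
    \<comment> \<open>\<open>U\<close> puts a row of ones above \<open>-2\<close> times
      \<open>B\<close>; \<open>T\<close> adds that row to all the others, which turns each entry
      \<open>-2 * b\<close> into the sign \<open>1 - 2 * b\<close> without changing the
      determinant.\<close>
    define T where "T = four_block_mat (1\<^sub>m 1) (0\<^sub>m 1 m) o2 (1\<^sub>m m)"
    define U where "U = four_block_mat (1\<^sub>m 1) o1 (0\<^sub>m m 1) ((-2) \<cdot>\<^sub>m B)"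
    have c: "o1 \<in> carrier_mat 1 m" "o2 \<in> carrier_mat m 1" "(-2) \<cdot>\<^sub>m B \<in> carrier_mat m m"
      using B by (auto simp: o1_def o2_def)
    have TU: "T \<in> carrier_mat n n" "U \<in> carrier_mat n n"
      unfolding T_def U_def n using c by (auto intro!: carrier_matI)
    have dT: "det T = 1" unfolding T_def
      using det_four_block_mat_upper_right_zero[of "1\<^sub>m 1" 1 "0\<^sub>m 1 m" m o2 "1\<^sub>m m"] c by simp
    have dU: "det U = (-2) ^ m * det B" unfolding U_def
      using det_four_block_mat_lower_left_zero[of "1\<^sub>m 1" 1 o1 m "0\<^sub>m m 1" "(-2) \<cdot>\<^sub>m B"] c B
      by (simp add: det_smult)
    have TUe: "T * U = four_block_mat (1\<^sub>m 1) o1 o2 (o2 * o1 + (-2) \<cdot>\<^sub>m B)"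
    proof -
      have "T * U = four_block_mat (1\<^sub>m 1 * 1\<^sub>m 1 + 0\<^sub>m 1 m * 0\<^sub>m m 1) (1\<^sub>m 1 * o1 + 0\<^sub>m 1 m * ((-2) \<cdot>\<^sub>m B))
          (o2 * 1\<^sub>m 1 + 1\<^sub>m m * 0\<^sub>m m 1) (o2 * o1 + 1\<^sub>m m * ((-2) \<cdot>\<^sub>m B))"
        unfolding T_def U_def by (rule mult_four_block_mat) (use c in auto)
      thus ?thesis using c left_mult_one_mat[OF c(3)] left_mult_zero_mat[OF c(3), of 1]
        right_add_zero_mat[OF c(1)] by simp
    qed
    have ent: "(T * U) $$ (i,j) \<in> {-1, 1}" if "i < n" "j < n" for i j
    proof (cases "i = 0 \<or> j = 0")
      case True
      thus ?thesis unfolding TUe using that B by (auto simp: n o1_def o2_def)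
    next
      case False
      then obtain i' j' where ij: "i = Suc i'" "j = Suc j'" by (metis not0_implies_Suc)
      have "(T * U) $$ (i,j) = 1 - 2 * B $$ (i',j')"
        unfolding TUe using that B ij by (simp add: n o1_def o2_def scalar_prod_def)
      moreover have "B $$ (i',j') \<in> {0,1}"
        using zB that ij unfolding zero_one_mat_def n by blast
      ultimately show ?thesis by auto
    qed
    have sq: "dot n (T * U) i i = real n" if "i < n" for i
    proof -
      have "dot n (T * U) i i = (\<Sum>l<n. 1)"
        unfolding dot_def using ent that by (intro sum.cong) force+
      thus ?thesis by simp
    qed
    have "(2 ^ m * \<bar>det B\<bar>)\<^sup>2 = (det (T * U))\<^sup>2"
      using det_mult[OF TU] dT dU by (simp add: power_mult_distrib power_even_abs flip: power_mult)
    also have "\<dots> \<le> (\<Prod>i<n. dot n (T * U) i i)"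
      by (rule hadamard_inequality) (use TU in auto)
    also have "\<dots> = real n ^ n" by (simp add: sq)
    also have "\<dots> = (real n powr (real n / 2))\<^sup>2"
      using assms by (simp add: power2_eq_square powr_realpow flip: powr_add)
    finally have "2 ^ m * \<bar>det B\<bar> \<le> real n powr (real n / 2)"
      by (rule power2_le_imp_le) auto
    thus ?thesis by (simp add: field_simps)
  qed
  moreover have "{\<bar>det B\<bar> | B. zero_one_mat m B} = (\<lambda>B. \<bar>det B\<bar>) ` {B. zero_one_mat m B}" by auto
  moreover have "zero_one_mat m (1\<^sub>m m)" by (auto simp: zero_one_mat_def)
  ultimately show ?thesis unfolding rho_def n diff_Suc_1 using finite_zero_one_mats[of m]
    by (intro Max.boundedI) auto
qed

subsection \<open>Gluing matrices\<close>

text \<open>Recording the size by its binary logarithm makes gluing additive in both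
  arguments.\<close>

definition attains :: "nat \<Rightarrow> real \<Rightarrow> bool" where
  "attains n t \<longleftrightarrow> (\<exists>A B i j. zero_one_mat n A \<and> B \<in> carrier_mat n n \<and> A * B = 1\<^sub>m n \<and>
     B * A = 1\<^sub>m n \<and> i < n \<and> j < n \<and> 2 powr t \<le> \<bar>B $$ (i,j)\<bar>)"

lemma attains_mono: "attains n t \<Longrightarrow> s \<le> t \<Longrightarrow> attains n s"
  unfolding attains_def by (meson order_trans powr_mono one_le_numeral)

lemma attains_0: "n \<ge> 1 \<Longrightarrow> attains n 0"
  unfolding attains_def
  by (rule exI[of _ "1\<^sub>m n"], rule exI[of _ "1\<^sub>m n"], rule exI[of _ 0], rule exI[of _ 0])
    (auto simp: zero_one_mat_def)

lemma attains_le_chi: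
  assumes "attains n t"
  shows "2 powr t \<le> chi n"
proof -
  obtain A B i j where *: "zero_one_mat n A" "B \<in> carrier_mat n n" "A * B = 1\<^sub>m n"
     "B * A = 1\<^sub>m n" "i < n" "j < n" "2 powr t \<le> \<bar>B $$ (i,j)\<bar>"
    using assms unfolding attains_def by blast
  have A: "A \<in> carrier_mat n n" using * by (simp add: zero_one_mat_def)
  hence inv: "inverts_mat A B" "inverts_mat B A" using * by (auto simp: inverts_mat_def)
  hence "invertible_mat A" unfolding invertible_mat_def using A by auto
  hence "\<bar>B $$ (i,j)\<bar> \<in> inverse_entries n" using * inv by blast
  hence "\<bar>B $$ (i,j)\<bar> \<le> chi n" unfolding chi_def using finite_inverse_entries by (intro Max_ge)
  thus ?thesis using *(7) by linarith
qed

text \<open>A block upper triangular matrix with off-diagonal block \<open>E\<close> has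
  \<open>- (A' * E * B')\<close> as the off-diagonal block of its inverse. Placing the single 1 of
  \<open>E\<close> at \<open>(j,k)\<close>, the column of the large entry of \<open>A'\<close> and
  the row of that of \<open>B'\<close>, makes their product appear at \<open>(i,l)\<close> of this
  block.\<close>

lemma attains_add:
  assumes "attains m s" "attains n t"
  shows "attains (m + n) (s + t)"
proof -
  obtain A A' i j where A: "zero_one_mat m A" "A' \<in> carrier_mat m m" "A * A' = 1\<^sub>m m"
     "A' * A = 1\<^sub>m m" "i < m" "j < m" "2 powr s \<le> \<bar>A' $$ (i,j)\<bar>"
    using assms unfolding attains_def by blast
  obtain B B' k l where B: "zero_one_mat n B" "B' \<in> carrier_mat n n" "B * B' = 1\<^sub>m n"
     "B' * B = 1\<^sub>m n" "k < n" "l < n" "2 powr t \<le> \<bar>B' $$ (k,l)\<bar>"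
    using assms unfolding attains_def by blast
  have c: "A \<in> carrier_mat m m" "B \<in> carrier_mat n n"
    using A B by (auto simp: zero_one_mat_def)
  define E where "E = mat m n (\<lambda>p. if p = (j,k) then 1 else 0 :: real)"
  have E: "E \<in> carrier_mat m n" by (simp add: E_def)
  define X where "X = - (A' * E * B')"
  have X: "X \<in> carrier_mat m n" using A B E by (simp add: X_def)
  define M where "M = four_block_mat A E (0\<^sub>m n m) B"
  define M' where "M' = four_block_mat A' X (0\<^sub>m n m) B'"
  have M: "M \<in> carrier_mat (m + n) (m + n)" "M' \<in> carrier_mat (m + n) (m + n)"
    unfolding M_def M'_def using c A B by auto
  have AX: "A * X = - (E * B')"
  proof -
    have "A * (A' * E * B') = E * B'"
      using assoc_mult_mat[OF c(1) mult_carrier_mat[OF A(2) E] B(2)]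
        assoc_mult_mat[OF c(1) A(2) E] A(3) left_mult_one_mat[OF E] by simp
    thus ?thesis unfolding X_def using c A(2) B(2) E
      by (simp add: uminus_mult_right_mat)
  qed
  have "M * M' = four_block_mat (A * A' + E * 0\<^sub>m n m) (A * X + E * B')
      (0\<^sub>m n m * A' + B * 0\<^sub>m n m) (0\<^sub>m n m * X + B * B')"
    unfolding M_def M'_def by (rule mult_four_block_mat) (use c A(2) B(2) E X in auto)
  also have "\<dots> = 1\<^sub>m (m + n)"
  proof -
    have "A * X + E * B' = 0\<^sub>m m n"
      unfolding AX using E B(2) by (intro uminus_l_inv_mat) auto
    thus ?thesis using c A(2,3) B(2,3) E X by simp
  qed
  finally have MM': "M * M' = 1\<^sub>m (m + n)" .
  have ent: "(A' * E * B') $$ (i,l) = A' $$ (i,j) * B' $$ (k,l)"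
  proof -
    have AE: "(A' * E) $$ (i,q) = (if q = k then A' $$ (i,j) else 0)" if "q < n" for q
    proof -
      have "(A' * E) $$ (i,q) = (\<Sum>p<m. A' $$ (i,p) * E $$ (p,q))"
        using that A(2,5) E by (simp add: scalar_prod_def atLeast0LessThan)
      also have "\<dots> = (\<Sum>p<m. if p = j then (if q = k then A' $$ (i,j) else 0) else 0)"
        using that by (intro sum.cong) (auto simp: E_def)
      finally show ?thesis using A(6) by simp
    qed
    have "(A' * E * B') $$ (i,l) = (\<Sum>q<n. (A' * E) $$ (i,q) * B' $$ (q,l))"
      using A(2,5) B(2,6) E
      by (subst index_mult_mat) (auto simp: scalar_prod_def atLeast0LessThan simp del: assoc_mult_mat)
    also have "\<dots> = (\<Sum>q<n. if q = k then A' $$ (i,j) * B' $$ (k,l) else 0)"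
      using AE by (intro sum.cong) auto
    finally show ?thesis using B(5) by simp
  qed
  have "M' $$ (i, m + l) = - (A' $$ (i,j) * B' $$ (k,l))"
    unfolding M'_def X_def using A(2,5) B(2,6) E ent by simp
  hence "\<bar>M' $$ (i, m + l)\<bar> = \<bar>A' $$ (i,j)\<bar> * \<bar>B' $$ (k,l)\<bar>" by (simp add: abs_mult)
  moreover have "2 powr (s + t) \<le> \<bar>A' $$ (i,j)\<bar> * \<bar>B' $$ (k,l)\<bar>"
    unfolding powr_add using A(7) B(7) by (intro mult_mono) auto
  moreover have "zero_one_mat (m + n) M"
    using A(1) B(1) c E M(1) by (auto simp: zero_one_mat_def M_def E_def)
  moreover have "M' * M = 1\<^sub>m (m + n)"
    using mat_mult_left_right_inverse[OF M MM'] .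
  ultimately show ?thesis unfolding attains_def using M MM' A(5) B(6)
    by (intro exI[of _ M] exI[of _ M'] exI[of _ i] exI[of _ "m + l"]) auto
qed

subsection \<open>Revolving-door order of the subsets\<close>

definition swaps :: "'a set \<Rightarrow> 'a set \<Rightarrow> bool" where
  "swaps S T \<longleftrightarrow> (\<exists>C a b. a \<notin> C \<and> b \<notin> C \<and> a \<noteq> b \<and> S = insert a C \<and> T = insert b C)"

definition grows :: "'a set \<Rightarrow> 'a set \<Rightarrow> bool" where
  "grows S T \<longleftrightarrow> (\<exists>a. a \<notin> S \<and> T = insert a S)"

lemma swaps_insert: "swaps S T \<Longrightarrow> v \<notin> S \<Longrightarrow> v \<notin> T \<Longrightarrow> swaps (insert v S) (insert v T)"
proof -
  assume S: "swaps S T" and v: "v \<notin> S" "v \<notin> T"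
  then obtain C a b where "a \<notin> C" "b \<notin> C" "a \<noteq> b" "S = insert a C" "T = insert b C"
    unfolding swaps_def by blast
  hence "a \<notin> insert v C" "b \<notin> insert v C" "a \<noteq> b"
    "insert v S = insert a (insert v C)" "insert v T = insert b (insert v C)" using v by auto
  thus ?thesis unfolding swaps_def by blast
qed

lemma inj_on_insert_Pow: "a \<notin> C \<Longrightarrow> inj_on (insert a) (Pow C)"
  by (intro inj_onI) (auto simp: insert_ident subset_iff)

lemma subsets_insert_split:
  assumes "v \<notin> V" "finite V"
  shows "{S. S \<subseteq> insert v V \<and> card S = Suc k} =
    {S. S \<subseteq> V \<and> card S = Suc k} \<union> insert v ` {S. S \<subseteq> V \<and> card S = k}"
proof (intro equalityI subsetI)
  fix S assume S: "S \<in> {S. S \<subseteq> insert v V \<and> card S = Suc k}"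
  hence fin: "finite S" using assms finite_subset by auto
  show "S \<in> {S. S \<subseteq> V \<and> card S = Suc k} \<union> insert v ` {S. S \<subseteq> V \<and> card S = k}"
  proof (cases "v \<in> S")
    case True
    hence "S = insert v (S - {v})" "S - {v} \<subseteq> V" "card (S - {v}) = k" using S fin by auto
    thus ?thesis by blast
  qed (use S in auto)
next
  fix S assume "S \<in> {S. S \<subseteq> V \<and> card S = Suc k} \<union> insert v ` {S. S \<subseteq> V \<and> card S = k}"
  moreover have "card (insert v S) = Suc (card S)" if "S \<subseteq> V" for S
    using that assms finite_subset by (subst card_insert_disjoint) auto
  ultimately show "S \<in> {S. S \<subseteq> insert v V \<and> card S = Suc k}" by auto
qed

text \<open>The free choice of the first set makes the induction go through: the last set never has to be tracked.\<close>

lemma revolving_door: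
  assumes "finite V" "A \<subseteq> V" "card A = k"
  shows "\<exists>xs. distinct xs \<and> set xs = {S. S \<subseteq> V \<and> card S = k} \<and> xs \<noteq> [] \<and> hd xs = A \<and>
    successively swaps xs"
  using assms
proof (induction "card V" arbitrary: V A k)
  case 0
  hence "V = {}" by auto
  thus ?case using 0 by (intro exI[of _ "[{}]"]) auto
next
  case (Suc m)
  consider "k = 0" | "A = V" | "k \<noteq> 0" "A \<noteq> V" by blast
  thus ?case
  proof cases
    case 1
    hence "S = {}" if "S \<subseteq> V" "card S = k" for S
      using that finite_subset[OF that(1) Suc.prems(1)] by simp
    hence "A = {}" "{S. S \<subseteq> V \<and> card S = k} = {{}}" using Suc.prems 1 by auto
    thus ?thesis by (intro exI[of _ "[{}]"]) auto
  next
    case 2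
    have "S = V" if "S \<subseteq> V" "card S = k" for S
      using card_subset_eq[OF Suc.prems(1) that(1)] that 2 Suc.prems(3) by simp
    hence "{S. S \<subseteq> V \<and> card S = k} = {A}" using 2 Suc.prems(3) by auto
    thus ?thesis by (intro exI[of _ "[A]"]) auto
  next
    case 3
    \<comment> \<open>The sets avoiding some \<open>v\<close> outside \<open>A\<close> come first,
      beginning with \<open>A\<close>; those containing \<open>v\<close> follow.\<close>
    then obtain v where v: "v \<in> V" "v \<notin> A" using Suc.prems by blast
    define W where "W = V - {v}"
    have W: "finite W" "m = card W" "A \<subseteq> W" "v \<notin> W" "V = insert v W"
      using Suc v by (auto simp: W_def)
    obtain l where k: "k = Suc l" using 3 by (cases k) auto
    obtain xs where xs: "distinct xs" "set xs = {S. S \<subseteq> W \<and> card S = k}" "xs \<noteq> []" "hd xs = A"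
      "successively swaps xs"
      using Suc.hyps(1)[OF W(2,1,3) Suc.prems(3)] by blast
    have L: "last xs \<subseteq> W" "card (last xs) = k" using xs(2,3) last_in_set by blast+
    then obtain b where b: "b \<in> last xs" using k by fastforce
    have fL: "finite (last xs)" using L W finite_subset by blast
    have "card (last xs - {b}) = l" using b L k fL by simp
    \<comment> \<open>Starting \<open>ys\<close> at \<open>last xs - {b}\<close> makes the passage
      between the two halves the exchange of \<open>b\<close> for \<open>v\<close>.\<close>
    then obtain ys where ys: "distinct ys" "set ys = {S. S \<subseteq> W \<and> card S = l}" "ys \<noteq> []"
      "hd ys = last xs - {b}" "successively swaps ys"
      using Suc.hyps(1)[OF W(2,1), of "last xs - {b}" l] L by blast
    have inj: "inj_on (insert v) (set ys)"
      using ys(2) by (intro inj_on_subset[OF inj_on_insert_Pow[OF W(4)]]) auto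
    have "successively (\<lambda>S T. swaps (insert v S) (insert v T)) ys"
      using ys(5) W(4) ys(2)
      by (intro successively_mono[OF ys(5)]) (auto intro!: swaps_insert)
    hence "successively swaps (map (insert v) ys)" by (simp add: successively_map)
    moreover have "swaps (last xs) (hd (map (insert v) ys))"
    proof -
      have "hd (map (insert v) ys) = insert v (last xs - {b})" using ys by (simp add: hd_map)
      moreover have "last xs = insert b (last xs - {b})" using b by blast
      moreover have "b \<noteq> v" "v \<notin> last xs" using b L W(4) by auto
      ultimately show ?thesis unfolding swaps_def by (metis Diff_iff insertI1)
    qed
    ultimately have "successively swaps (xs @ map (insert v) ys)"
      using xs(5) by (simp add: successively_append_iff)
    moreover have "distinct (xs @ map (insert v) ys)"
      using xs(1,2) ys(1) inj W(4) by (auto simp: distinct_map)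
    moreover have "set (xs @ map (insert v) ys) = {S. S \<subseteq> V \<and> card S = k}"
      unfolding W(5) k using subsets_insert_split[OF W(4,1)] xs(2) ys(2) k by simp
    ultimately show ?thesis using xs(3,4)
      by (intro exI[of _ "xs @ map (insert v) ys"]) (auto simp: hd_append)
  qed
qed

text \<open>Layers are concatenated: as \<open>revolving_door\<close> allows any first set, the next
  layer can start at the last set of the current one enlarged by one element.\<close>

lemma layered_order_upto:
  assumes "finite V" "k \<le> card V"
  shows "\<exists>xs. distinct xs \<and> set xs = {S. S \<subseteq> V \<and> card S \<le> k} \<and> xs \<noteq> [] \<and> hd xs = {} \<and>
    card (last xs) = k \<and> sorted (map card xs) \<and> successively (\<lambda>S T. swaps S T \<or> grows S T) xs"
  using assms(2)
proof (induction k)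
  case 0
  have "S = {}" if "S \<subseteq> V" "card S \<le> 0" for S
    using that finite_subset[OF that(1) assms(1)] by simp
  hence "{S. S \<subseteq> V \<and> card S \<le> 0} = {{}}" by auto
  thus ?case by (intro exI[of _ "[{}]"]) auto
next
  case (Suc k)
  then obtain xs where xs: "distinct xs" "set xs = {S. S \<subseteq> V \<and> card S \<le> k}" "xs \<noteq> []" "hd xs = {}"
    "card (last xs) = k" "sorted (map card xs)" "successively (\<lambda>S T. swaps S T \<or> grows S T) xs" by auto
  have L: "last xs \<subseteq> V" using xs(2,3) last_in_set by blast
  hence "last xs \<noteq> V" using xs(5) Suc.prems by auto
  then obtain c where c: "c \<in> V" "c \<notin> last xs" using L by blast
  have "finite (last xs)" using L assms finite_subset by blast
  hence "card (insert c (last xs)) = Suc k" using c xs(5) by simp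
  then obtain ys where ys: "distinct ys" "set ys = {S. S \<subseteq> V \<and> card S = Suc k}" "ys \<noteq> []"
      "hd ys = insert c (last xs)" "successively swaps ys"
    using revolving_door[OF assms(1), of "insert c (last xs)" "Suc k"] c L by blast
  have "successively (\<lambda>S T. swaps S T \<or> grows S T) ys"
    by (rule successively_mono[OF ys(5)]) auto
  moreover have "grows (last xs) (hd ys)" unfolding grows_def using c ys by auto
  ultimately have "successively (\<lambda>S T. swaps S T \<or> grows S T) (xs @ ys)"
    using xs(7) by (simp add: successively_append_iff)
  moreover have "map card ys = replicate (length ys) (Suc k)"
    using ys(2) by (intro replicate_eqI) auto
  hence "sorted (map card (xs @ ys))"
    using xs(2,6) by (auto simp: sorted_append)
  moreover have "distinct (xs @ ys)" using xs(1,2) ys(1,2) by auto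
  moreover have "set (xs @ ys) = {S. S \<subseteq> V \<and> card S \<le> Suc k}" using xs(2) ys(2) by auto
  moreover have "card (last (xs @ ys)) = Suc k" using ys(2,3) last_in_set[OF ys(3)] by auto
  ultimately show ?case using xs(3,4)
    by (intro exI[of _ "xs @ ys"]) (auto simp: hd_append)
qed

lemma layered_order:
  fixes V :: "'a set"
  assumes "finite V"
  obtains \<alpha> :: "nat \<Rightarrow> 'a set" where "bij_betw \<alpha> {..<2 ^ card V} (Pow V)" "\<alpha> 0 = {}"
    "\<And>i j. i \<le> j \<Longrightarrow> j < 2 ^ card V \<Longrightarrow> card (\<alpha> i) \<le> card (\<alpha> j)"
    "\<And>i. Suc i < 2 ^ card V \<Longrightarrow> swaps (\<alpha> i) (\<alpha> (Suc i)) \<or> grows (\<alpha> i) (\<alpha> (Suc i))"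
proof -
  obtain xs where xs: "distinct xs" "set xs = {S. S \<subseteq> V \<and> card S \<le> card V}" "xs \<noteq> []" "hd xs = {}"
    "sorted (map card xs)" "successively (\<lambda>S T. swaps S T \<or> grows S T) xs"
    using layered_order_upto[OF assms order_refl] by blast
  have set: "set xs = Pow V" using xs(2) assms card_mono by auto
  have len: "length xs = 2 ^ card V"
    using distinct_card[OF xs(1)] set card_Pow[OF assms] by simp
  show ?thesis
  proof (rule that[of "(!) xs"])
    show "bij_betw ((!) xs) {..<2 ^ card V} (Pow V)"
      by (rule bij_betw_nth) (use xs len set in auto)
    show "xs ! 0 = {}" using xs hd_conv_nth by metis
    show "card (xs ! i) \<le> card (xs ! j)" if "i \<le> j" "j < 2 ^ card V" for i j
      using sorted_nth_mono[OF xs(5), of i j] that len by simp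
    show "swaps (xs ! i) (xs ! Suc i) \<or> grows (xs ! i) (xs ! Suc i)" if "Suc i < 2 ^ card V" for i
      using xs(6) that len unfolding successively_conv_nth by auto
  qed
qed

subsection \<open>Walsh functions\<close>

text \<open>The character attached to \<open>S\<close> on the group of subsets under symmetric
  difference, evaluated at \<open>x\<close>.\<close>

definition walsh :: "'a set \<Rightarrow> 'a set \<Rightarrow> real" where
  "walsh S x = (-1) ^ card (S \<inter> x)"

lemma walsh_cases: "walsh S x = 1 \<or> walsh S x = -1"
  unfolding walsh_def by (cases "even (card (S \<inter> x))") auto

lemma walsh_empty [simp]: "walsh {} x = 1" by (simp add: walsh_def)

lemma walsh_commute: "walsh S x = walsh x S" by (simp add: walsh_def Int_commute)

lemma walsh_insert:
  assumes "finite S" "a \<notin> S"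
  shows "walsh (insert a S) x = (if a \<in> x then - walsh S x else walsh S x)"
  using assms by (auto simp: walsh_def)

text \<open>Elements of \<open>S \<inter> T \<inter> x\<close> are counted twice, so they do not
  affect the sign.\<close>

lemma walsh_sym_diff:
  assumes "finite S" "finite T"
  shows "walsh S x * walsh T x = walsh ((S - T) \<union> (T - S)) x"
proof -
  have S: "card (S \<inter> x) = card ((S - T) \<inter> x) + card (S \<inter> T \<inter> x)"
    using assms by (subst card_Un_disjoint[symmetric]) (auto intro: arg_cong[of _ _ card])
  have T: "card (T \<inter> x) = card ((T - S) \<inter> x) + card (S \<inter> T \<inter> x)"
    using assms by (subst card_Un_disjoint[symmetric]) (auto intro: arg_cong[of _ _ card])
  have "card (((S - T) \<union> (T - S)) \<inter> x) = card ((S - T) \<inter> x) + card ((T - S) \<inter> x)"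
    using assms by (subst card_Un_disjoint[symmetric]) (auto intro: arg_cong[of _ _ card])
  thus ?thesis unfolding walsh_def S T
    by (simp add: power_add mult_ac flip: power_mult_distrib)
qed

lemma sum_Pow_insert:
  assumes "finite C" "a \<notin> C"
  shows "(\<Sum>S\<in>Pow (insert a C). f S) = (\<Sum>S\<in>Pow C. f S + (f (insert a S) :: real))"
proof -
  have "Pow C \<inter> insert a ` Pow C = {}" using assms by auto
  thus ?thesis unfolding Pow_insert using assms inj_on_insert_Pow[OF assms(2)]
    by (subst sum.union_disjoint) (auto simp: sum.reindex sum.distrib)
qed

text \<open>The sum factorises over the elements of \<open>C\<close>, each contributing a factor 0
  or 2 according to whether it lies in \<open>x\<close>.\<close>

lemma sum_walsh_Pow:
  assumes "finite C"
  shows "(\<Sum>S\<in>Pow C. walsh S x) = (if C \<inter> x = {} then 2 ^ card C else 0)"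
  using assms
proof (induction C rule: finite_induct)
  case (insert a C)
  have "(\<Sum>S\<in>Pow (insert a C). walsh S x) = (\<Sum>S\<in>Pow C. walsh S x + walsh (insert a S) x)"
    using insert by (intro sum_Pow_insert)
  also have "\<dots> = (\<Sum>S\<in>Pow C. if a \<in> x then 0 else 2 * walsh S x)"
  proof (intro sum.cong refl)
    fix S assume "S \<in> Pow C"
    hence "finite S" "a \<notin> S" using insert.hyps finite_subset by auto
    thus "walsh S x + walsh (insert a S) x = (if a \<in> x then 0 else 2 * walsh S x)"
      by (simp add: walsh_insert)
  qed
  also have "\<dots> = (if a \<in> x then 0 else 2 * (\<Sum>S\<in>Pow C. walsh S x))"
    by (simp add: sum_distrib_left)
  finally show ?case using insert by auto
qed simp

text \<open>The product is a single character, and exchanging the arguments of \<open>walsh\<close>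
  turns the sum over points into the sum of \<open>sum_walsh_Pow\<close>.\<close>

lemma walsh_orthogonal:
  assumes "finite V" "S \<subseteq> V" "T \<subseteq> V"
  shows "(\<Sum>x\<in>Pow V. walsh S x * walsh T x) = (if S = T then 2 ^ card V else 0)"
proof -
  have "finite S" "finite T" using assms finite_subset by auto
  hence "(\<Sum>x\<in>Pow V. walsh S x * walsh T x) = (\<Sum>x\<in>Pow V. walsh x ((S - T) \<union> (T - S)))"
    by (intro sum.cong refl) (simp only: walsh_sym_diff walsh_commute[of _ "sym_diff S T"])
  also have "\<dots> = (if V \<inter> ((S - T) \<union> (T - S)) = {} then 2 ^ card V else 0)"
    by (rule sum_walsh_Pow[OF assms(1)])
  also have "V \<inter> ((S - T) \<union> (T - S)) = {} \<longleftrightarrow> S = T" using assms by auto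
  finally show ?thesis by simp
qed

text \<open>
  The sum over \<open>F\<close>, divided by \<open>2 ^ card T\<close>, is the character of \<open>S\<close> on an affine subspace where that
  character is 1 (if \<open>T\<close> extends \<open>S\<close>) or agrees with that of \<open>T\<close> (if \<open>T\<close> arises by an exchange),
  and 0 elsewhere.
\<close>

lemma row_support_exists:
  assumes "finite V" "S \<subseteq> V" "T \<subseteq> V" and step: "swaps S T \<or> grows S T"
  obtains F where "F \<subseteq> Pow V" "S \<in> F" "T \<in> F"
    "\<And>R. R \<in> F \<Longrightarrow> R \<noteq> S \<Longrightarrow> R \<noteq> T \<Longrightarrow> card R < card T"
    "\<And>x. (1 + walsh S x) / 2 - (\<Sum>R\<in>F. walsh R x) / 2 ^ card T \<in> {0, 1}"
  using step
proof
  assume "grows S T"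
  then obtain a where a: "a \<notin> S" "T = insert a S" unfolding grows_def by blast
  have fin: "finite S" "finite T" using assms finite_subset by auto
  \<comment> \<open>The sum over \<open>Pow T\<close> is \<open>2 ^ card T\<close> where
    \<open>T \<inter> x = {}\<close> and 0 elsewhere. On that set the character of \<open>S\<close>
    is 1, so the value changes from 1 to 0 there.\<close>
  show ?thesis
  proof (rule that[of "Pow T"])
    show "card R < card T" if "R \<in> Pow T" "R \<noteq> S" "R \<noteq> T" for R
      using that fin by (auto intro: psubset_card_mono)
    show "(1 + walsh S x) / 2 - (\<Sum>R\<in>Pow T. walsh R x) / 2 ^ card T \<in> {0, 1}" for x
    proof (cases "T \<inter> x = {}")
      case True
      hence "walsh S x = 1" using a by (auto simp: walsh_def)
      thus ?thesis using True by (simp add: sum_walsh_Pow[OF fin(2)])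
    next
      case False
      thus ?thesis using walsh_cases[of S x] by (auto simp: sum_walsh_Pow[OF fin(2)])
    qed
  qed (use assms a in auto)
next
  assume "swaps S T"
  then obtain C a b where C: "a \<notin> C" "b \<notin> C" "a \<noteq> b" "S = insert a C" "T = insert b C"
    unfolding swaps_def by blast
  have fin: "finite C" using assms C finite_subset by auto
  define F where "F = insert a ` Pow C \<union> insert b ` Pow C"
  show ?thesis
  proof (rule that[of F])
    show "F \<subseteq> Pow V" "S \<in> F" "T \<in> F" using assms C by (auto simp: F_def)
    show "card R < card T" if R: "R \<in> F" "R \<noteq> S" "R \<noteq> T" for R
    proof -
      obtain D c where D: "D \<subseteq> C" "R = insert c D" "D \<noteq> C"
        using R C by (auto simp: F_def)
      have "card R \<le> Suc (card D)" unfolding D(2) by (rule card_insert_le_m1) auto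
      also have "\<dots> < Suc (card C)" using D fin psubset_card_mono by auto
      finally show ?thesis using C fin by simp
    qed
    fix x
    have inj: "inj_on (insert a) (Pow C)" "inj_on (insert b) (Pow C)"
      by (rule inj_on_insert_Pow[OF C(1)], rule inj_on_insert_Pow[OF C(2)])
    have ins: "walsh (insert c D) x = (if c \<in> x then -1 else 1) * walsh D x"
      if "D \<in> Pow C" "c \<notin> C" for c D
      using that fin finite_subset by (subst walsh_insert) auto
    have "(\<Sum>R\<in>F. walsh R x) = (\<Sum>D\<in>Pow C. walsh (insert a D) x) + (\<Sum>D\<in>Pow C. walsh (insert b D) x)"
      unfolding F_def using fin C inj
      by (subst sum.union_disjoint) (auto simp: sum.reindex)
    also have "\<dots> = ((if a \<in> x then -1 else 1) + (if b \<in> x then -1 else 1)) * (\<Sum>D\<in>Pow C. walsh D x)"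
      using C by (simp add: ins sum_distrib_left sum_negf)
    finally have sum: "(\<Sum>R\<in>F. walsh R x) =
      ((if a \<in> x then -1 else 1) + (if b \<in> x then -1 else 1)) * (if C \<inter> x = {} then 2 ^ card C else 0)"
      unfolding sum_walsh_Pow[OF fin] .
    have S: "walsh S x = (if a \<in> x then -1 else 1) * walsh C x"
      unfolding C(4) by (rule ins) (use C in auto)
    have T: "card T = Suc (card C)" using C fin by simp
    show "(1 + walsh S x) / 2 - (\<Sum>R\<in>F. walsh R x) / 2 ^ card T \<in> {0, 1}"
    proof (cases "C \<inter> x = {}")
      case True
      hence "walsh C x = 1" by (simp add: walsh_def)
      \<comment> \<open>With \<open>s\<close> and \<open>t\<close> the signs belonging to
        \<open>a\<close> and \<open>b\<close>, the expression is
        \<open>(1 + s) / 2 - (s + t) / 2 = (1 - t) / 2\<close>.\<close>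
      thus ?thesis unfolding sum S T using True by (auto simp: field_simps)
    next
      case False
      hence "(\<Sum>R\<in>F. walsh R x) = 0" using sum by simp
      thus ?thesis using walsh_cases[of S x] by auto
    qed
  qed
qed

subsection \<open>Ill-conditioned matrices of order a power of two\<close>

text \<open>The solution of a lower triangular system as an explicit recursion, whose growth can be
  estimated step by step.\<close>

fun forward_subst :: "(nat \<Rightarrow> nat \<Rightarrow> real) \<Rightarrow> (nat \<Rightarrow> real) \<Rightarrow> nat \<Rightarrow> real" where
  "forward_subst L b i = (b i - (\<Sum>j<i. L i j * forward_subst L b j)) / L i i"

declare forward_subst.simps [simp del]

lemma forward_subst_solves:
  assumes "L i i \<noteq> 0"
  shows "(\<Sum>j\<le>i. L i j * forward_subst L b j) = b i"
proof -
  have "L i i * forward_subst L b i = b i - (\<Sum>j<i. L i j * forward_subst L b j)"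
    using assms by (subst forward_subst.simps) simp
  thus ?thesis by (simp add: lessThan_Suc_atMost[symmetric])
qed

lemma forward_subst_eq_0:
  assumes "\<And>j. j \<le> i \<Longrightarrow> b j = 0"
  shows "forward_subst L b i = 0"
  using assms
proof (induction i rule: less_induct)
  case (less i)
  hence "(\<Sum>j<i. L i j * forward_subst L b j) = 0" by (intro sum.neutral) auto
  thus ?case using less.prems[of i] by (subst forward_subst.simps) simp
qed

lemma inverse_mat_exists:
  fixes A :: "real mat"
  assumes A: "A \<in> carrier_mat n n" and "det A \<noteq> 0"
  obtains B where "B \<in> carrier_mat n n" "A * B = 1\<^sub>m n" "B * A = 1\<^sub>m n"
proof (rule that[of "(1 / det A) \<cdot>\<^sub>m adj_mat A"])
  note adj = adj_mat[OF A]
  show "(1 / det A) \<cdot>\<^sub>m adj_mat A \<in> carrier_mat n n" using adj by simp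
  show "A * ((1 / det A) \<cdot>\<^sub>m adj_mat A) = 1\<^sub>m n"
    using mult_smult_distrib[OF A adj(1)] adj(2) assms(2) by (auto intro!: eq_matI)
  show "(1 / det A) \<cdot>\<^sub>m adj_mat A * A = 1\<^sub>m n"
    using mult_smult_assoc_mat[OF adj(1) A] adj(3) assms(2) by (auto intro!: eq_matI)
qed

text \<open>
  A lower bound for the logarithm of the growth factor \<open>2 ^ (k - 1) - 2\<close> of a step onto a \<open>k\<close>-set.
  It is nonpositive for \<open>k \<le> 2\<close>, so that it may be summed over all sets.
\<close>

definition weight :: "nat \<Rightarrow> real" where
  "weight k = real k - 1 - 16 / 2 ^ k"

lemma weight_nonpos: "k \<le> 2 \<Longrightarrow> weight k \<le> 0"
proof -
  assume "k \<le> 2"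
  then consider "k = 0" | "k = 1" | "k = 2" by linarith
  thus ?thesis by cases (auto simp: weight_def)
qed

text \<open>Factoring out \<open>2 ^ (k - 1)\<close> leaves
  \<open>2 powr (- 4 * u) \<le> 1 - u\<close> for \<open>u = 4 / 2 ^ k\<close>; this is where the 16
  in \<open>weight\<close> comes from.\<close>

lemma powr_weight_le:
  assumes "k \<ge> 3"
  shows "2 powr weight k \<le> 2 ^ (k - 1) - 2"
proof -
  obtain j where k: "k = j + 3" using assms by (metis add.commute le_Suc_ex)
  define u :: real where "u = 4 / 2 ^ k"
  have u: "0 < u" "u \<le> 1 / 2" by (auto simp: u_def k power_add field_simps)
  \<comment> \<open>This gives \<open>ln 2 \<ge> 1 / 2\<close>, whence \<open>2 powr (- 4 * u) \<le>
    exp (- (2 * u)) \<le> 1 / (1 + 2 * u) \<le> 1 - u\<close>.\<close>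
  have "ln (1 / 2) \<le> 1 / 2 - (1 :: real)" by (rule ln_le_minus_one) simp
  hence "2 * u \<le> 4 * u * ln 2" using u by (simp add: ln_div)
  hence "2 powr (- 4 * u) \<le> exp (- (2 * u))" by (simp add: powr_def)
  also have "\<dots> = 1 / exp (2 * u)" by (simp add: exp_minus field_simps)
  also have "\<dots> \<le> 1 / (1 + 2 * u)" using u exp_ge_add_one_self[of "2 * u"] by (intro divide_left_mono) auto
  also have "\<dots> \<le> 1 - u"
  proof -
    have "u * (1 - 2 * u) \<ge> 0" using u by simp
    hence "1 \<le> (1 - u) * (1 + 2 * u)" by (simp add: algebra_simps)
    thus ?thesis using u by (simp add: field_simps)
  qed
  finally have *: "2 powr (- 4 * u) \<le> 1 - u" .
  have "weight k = real (k - 1) + - 4 * u" using assms by (simp add: weight_def u_def of_nat_diff)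
  hence "2 powr weight k = 2 ^ (k - 1) * 2 powr (- 4 * u)" by (simp only: powr_add) (simp add: powr_realpow)
  also have "\<dots> \<le> 2 ^ (k - 1) * (1 - u)" using * by (intro mult_left_mono) auto
  also have "\<dots> = 2 ^ (k - 1) - 2" by (simp add: u_def k power_add field_simps)
  finally show ?thesis .
qed

section \<open>Summing the weights over all subsets\<close>

lemma sum_card_Pow: "finite V \<Longrightarrow> (\<Sum>S\<in>Pow V. real (card S)) = real (card V) * 2 ^ card V / 2"
proof (induction V rule: finite_induct)
  case (insert a V)
  have "(\<Sum>S\<in>Pow (insert a V). real (card S)) = (\<Sum>S\<in>Pow V. real (card S) + real (card (insert a S)))"
    using insert by (intro sum_Pow_insert)
  also have "\<dots> = (\<Sum>S\<in>Pow V. 2 * real (card S) + 1)"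
  proof (intro sum.cong refl)
    fix S assume "S \<in> Pow V"
    hence "finite S" "a \<notin> S" using insert.hyps finite_subset by auto
    thus "real (card S) + real (card (insert a S)) = 2 * real (card S) + 1" by simp
  qed
  also have "\<dots> = 2 * (\<Sum>S\<in>Pow V. real (card S)) + 2 ^ card V"
    using insert.hyps by (simp add: sum.distrib sum_distrib_left card_Pow)
  finally show ?case using insert by (simp add: algebra_simps)
qed simp

lemma sum_half_power_card_Pow: "finite V \<Longrightarrow> (\<Sum>S\<in>Pow V. 1 / 2 ^ card S :: real) = (3 / 2) ^ card V"
proof (induction V rule: finite_induct)
  case (insert a V)
  have "(\<Sum>S\<in>Pow (insert a V). 1 / 2 ^ card S) = (\<Sum>S\<in>Pow V. 1 / 2 ^ card S + 1 / 2 ^ card (insert a S) :: real)"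
    using insert by (intro sum_Pow_insert)
  also have "\<dots> = (\<Sum>S\<in>Pow V. 3 / 2 * (1 / 2 ^ card S))"
  proof (intro sum.cong refl)
    fix S assume "S \<in> Pow V"
    hence "finite S" "a \<notin> S" using insert.hyps finite_subset by auto
    thus "1 / 2 ^ card S + 1 / 2 ^ card (insert a S) = 3 / 2 * (1 / 2 ^ card S :: real)" by simp
  qed
  also have "\<dots> = 3 / 2 * (3 / 2) ^ card V" by (simp only: sum_distrib_left[symmetric] insert.IH)
  finally show ?case using insert.hyps by simp
qed simp

text \<open>For \<open>N = 2 ^ card V\<close> the last term is a multiple of
  \<open>N powr log 2 (3 / 2)\<close>, a power below the first; it is the source of the sublinear
  error.\<close>

lemma sum_weight_Pow:
  assumes "finite V"
  shows "(\<Sum>S\<in>Pow V. weight (card S)) = real (card V) * 2 ^ card V / 2 - 2 ^ card V - 16 * (3 / 2) ^ card V"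
proof -
  have "(\<Sum>S\<in>Pow V. weight (card S)) =
      (\<Sum>S\<in>Pow V. real (card S)) - (\<Sum>S\<in>Pow V. 1) - 16 * (\<Sum>S\<in>Pow V. 1 / 2 ^ card S)"
    by (simp add: weight_def sum_subtractf sum_distrib_left)
  thus ?thesis using sum_card_Pow[OF assms] sum_half_power_card_Pow[OF assms] card_Pow[OF assms] by simp
qed

text \<open>If \<open>B\<close> inverts \<open>M = Lm * Q\<close>, then \<open>Q * B\<close> inverts
  \<open>Lm\<close>. Hence a large coordinate of a solution of the triangular system is a signed sum
  of \<open>N\<close> entries of one column of \<open>B\<close>, up to a factor of size at most 1.
  One of these entries has at least the average size, which costs \<open>card V\<close> in the
  exponent.\<close>

lemma attains_layered:
  assumes V: "finite V" "V \<noteq> {}"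
  shows "attains (2 ^ card V) ((\<Sum>S\<in>Pow V. weight (card S)) - real (card V))"
proof -
  define N :: nat where "N = 2 ^ card V"
  obtain \<alpha> where bij: "bij_betw \<alpha> {..<N} (Pow V)" and \<alpha>0: "\<alpha> 0 = {}"
    and mono: "\<And>i j. i \<le> j \<Longrightarrow> j < N \<Longrightarrow> card (\<alpha> i) \<le> card (\<alpha> j)"
    and step: "\<And>i. Suc i < N \<Longrightarrow> swaps (\<alpha> i) (\<alpha> (Suc i)) \<or> grows (\<alpha> i) (\<alpha> (Suc i))"
    using layered_order[OF V(1)] unfolding N_def by blast
  have \<alpha>V: "\<alpha> i \<subseteq> V" if "i < N" for i using bij that bij_betwE by fastforce
  have inj: "\<alpha> i = \<alpha> j \<longleftrightarrow> i = j" if "i < N" "j < N" for i j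
    using bij that by (auto simp: bij_betw_def inj_on_def)
  have "\<forall>i. \<exists>F. Suc i < N \<longrightarrow> F \<subseteq> Pow V \<and> \<alpha> i \<in> F \<and> \<alpha> (Suc i) \<in> F \<and>
      (\<forall>R\<in>F. R \<noteq> \<alpha> i \<longrightarrow> R \<noteq> \<alpha> (Suc i) \<longrightarrow> card R < card (\<alpha> (Suc i))) \<and>
      (\<forall>x. (1 + walsh (\<alpha> i) x) / 2 - (\<Sum>R\<in>F. walsh R x) / 2 ^ card (\<alpha> (Suc i)) \<in> {0, 1})"
    (is "\<forall>i. \<exists>F. ?P i F")
  proof
    fix i
    show "\<exists>F. ?P i F"
    proof (cases "Suc i < N")
      case True
      then obtain F where "F \<subseteq> Pow V" "\<alpha> i \<in> F" "\<alpha> (Suc i) \<in> F"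
        "\<And>R. R \<in> F \<Longrightarrow> R \<noteq> \<alpha> i \<Longrightarrow> R \<noteq> \<alpha> (Suc i) \<Longrightarrow> card R < card (\<alpha> (Suc i))"
        "\<And>x. (1 + walsh (\<alpha> i) x) / 2 - (\<Sum>R\<in>F. walsh R x) / 2 ^ card (\<alpha> (Suc i)) \<in> {0, 1}"
        using row_support_exists[OF V(1) \<alpha>V[of i] \<alpha>V[of "Suc i"] step[of i]] by auto
      thus ?thesis by (intro exI[of _ F]) blast
    qed blast
  qed
  then obtain F where F: "\<And>i. ?P i (F i)" using choice by metis
  define J where "J i = {j. j < N \<and> \<alpha> j \<in> F i}" for i
  \<comment> \<open>The sets of \<open>F i\<close> other than the two neighbours are strictly
    smaller than \<open>\<alpha> (Suc i)\<close>, so they come earlier in the order; this makes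
    \<open>L\<close> lower triangular.\<close>
  have J: "i \<in> J i" "Suc i \<in> J i" "J i \<subseteq> {..Suc i}" "finite (J i)" if i: "Suc i < N" for i
  proof -
    show "i \<in> J i" "Suc i \<in> J i" using F[of i] i by (auto simp: J_def)
    show "J i \<subseteq> {..Suc i}"
    proof
      fix j assume j: "j \<in> J i"
      show "j \<in> {..Suc i}"
      proof (rule ccontr)
        assume "j \<notin> {..Suc i}"
        hence "Suc i < j" by simp
        moreover have "j < N" "\<alpha> j \<in> F i" using j by (auto simp: J_def)
        ultimately have "card (\<alpha> j) < card (\<alpha> (Suc i))"
          using F[of i] i inj[of j i] inj[of j "Suc i"] by auto
        thus False using mono[of "Suc i" j] \<open>Suc i < j\<close> \<open>j < N\<close> by simp
      qed
    qed
    thus "finite (J i)" by (rule finite_subset) auto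
  qed
  \<comment> \<open>Row \<open>Suc i'\<close> holds the Walsh coefficients of the 0-1 function from
    \<open>row_support_exists\<close>. The constant 1/2 sits at index 0 because
    \<open>\<alpha> 0\<close> is empty; for \<open>i' = 0\<close> both halves fall on that index and
    add up.\<close>
  define L where "L i j = (case i of 0 \<Rightarrow> if j = 0 then 1 else 0
    | Suc i' \<Rightarrow> (if j = 0 then 1 / 2 else 0) + (if j = i' then 1 / 2 else 0)
        - (if j \<in> J i' then 1 / 2 ^ card (\<alpha> i) else 0 :: real))" for i j
  have L_upper: "L i j = 0" if "i < j" "j < N" for i j
    using that J(3)[of "i - 1"] by (cases i) (auto simp: L_def)
  have L_diag: "L i i = (if i = 0 then 1 else - 1 / 2 ^ card (\<alpha> i))" if "i < N" for i
    using that J(2)[of "i - 1"] by (cases i) (auto simp: L_def)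
  have N0: "0 < N" by (simp add: N_def)
  have L_sum: "(\<Sum>j<N. L (Suc i) j * f j) =
      f 0 / 2 + f i / 2 - (\<Sum>j\<in>J i. f j) / 2 ^ card (\<alpha> (Suc i))" if "Suc i < N" for i f
  proof -
    have "(\<Sum>j<N. L (Suc i) j * f j) = (\<Sum>j<N. (if j = 0 then f 0 / 2 else 0) +
        (if j = i then f i / 2 else 0) - (if j \<in> J i then f j / 2 ^ card (\<alpha> (Suc i)) else 0))"
      by (intro sum.cong) (auto simp: L_def algebra_simps)
    also have "\<dots> = f 0 / 2 + f i / 2 - (\<Sum>j<N. if j \<in> J i then f j / 2 ^ card (\<alpha> (Suc i)) else 0)"
      using that N0 by (simp add: sum.distrib sum_subtractf)
    also have "(\<Sum>j<N. if j \<in> J i then f j / 2 ^ card (\<alpha> (Suc i)) else 0) = (\<Sum>j\<in>J i. f j / 2 ^ card (\<alpha> (Suc i)))"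
      by (intro sum.mono_neutral_cong_right) (auto simp: J_def)
    finally show ?thesis by (simp add: sum_divide_distrib)
  qed

  \<comment> \<open>The 0-1 matrix \<open>M\<close> and its invertibility\<close>
  define Lm where "Lm = mat N N (\<lambda>(i,j). L i j)"
  define Q where "Q = mat N N (\<lambda>(i,j). walsh (\<alpha> i) (\<alpha> j))"
  define M where "M = Lm * Q"
  have c: "Lm \<in> carrier_mat N N" "Q \<in> carrier_mat N N" "M \<in> carrier_mat N N"
    by (auto simp: Lm_def Q_def M_def)
  have M01: "zero_one_mat N M"
    unfolding zero_one_mat_def
  proof (intro conjI c allI impI)
    fix i l assume il: "i < N" "l < N"
    have M_eq: "M $$ (i,l) = (\<Sum>j<N. L i j * walsh (\<alpha> j) (\<alpha> l))"
      using il by (simp add: M_def Lm_def Q_def scalar_prod_def atLeast0LessThan)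
    show "M $$ (i,l) \<in> {0,1}"
    proof (cases i)
      case 0
      have "M $$ (i,l) = (\<Sum>j<N. if j = 0 then 1 else 0)"
        unfolding M_eq unfolding 0 by (intro sum.cong) (auto simp: L_def \<alpha>0)
      thus ?thesis using N0 by simp
    next
      case (Suc i')
      have bJ: "bij_betw \<alpha> (J i') (F i')"
      proof (rule bij_betw_subset[OF bij])
        have "F i' \<subseteq> \<alpha> ` {..<N}" using F[of i'] Suc il bij by (auto simp: bij_betw_def)
        thus "\<alpha> ` J i' = F i'" unfolding J_def by blast
      qed (auto simp: J_def)
      have "M $$ (i,l) = (1 + walsh (\<alpha> i') (\<alpha> l)) / 2
          - (\<Sum>j\<in>J i'. walsh (\<alpha> j) (\<alpha> l)) / 2 ^ card (\<alpha> (Suc i'))"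
        unfolding M_eq unfolding Suc using L_sum[of i' "\<lambda>j. walsh (\<alpha> j) (\<alpha> l)"] il Suc
        by (simp add: \<alpha>0 add_divide_distrib)
      also have "(\<Sum>j\<in>J i'. walsh (\<alpha> j) (\<alpha> l)) = (\<Sum>R\<in>F i'. walsh R (\<alpha> l))"
        by (rule sum.reindex_bij_betw[OF bJ])
      finally show ?thesis using F[of i'] il Suc by auto
    qed
  qed
  have "Q * transpose_mat Q = real N \<cdot>\<^sub>m 1\<^sub>m N"
  proof (rule eq_matI)
    fix i j assume "i < dim_row (real N \<cdot>\<^sub>m 1\<^sub>m N)" "j < dim_col (real N \<cdot>\<^sub>m 1\<^sub>m N)"
    hence ij: "i < N" "j < N" by auto
    have "(Q * transpose_mat Q) $$ (i,j) = (\<Sum>l<N. walsh (\<alpha> i) (\<alpha> l) * walsh (\<alpha> j) (\<alpha> l))"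
      using ij by (simp add: Q_def scalar_prod_def atLeast0LessThan)
    also have "\<dots> = (\<Sum>x\<in>Pow V. walsh (\<alpha> i) x * walsh (\<alpha> j) x)"
      by (rule sum.reindex_bij_betw[OF bij])
    also have "\<dots> = (if i = j then real N else 0)"
      using walsh_orthogonal[OF V(1) \<alpha>V[OF ij(1)] \<alpha>V[OF ij(2)]] inj[OF ij] by (simp add: N_def)
    finally show "(Q * transpose_mat Q) $$ (i,j) = (real N \<cdot>\<^sub>m 1\<^sub>m N) $$ (i,j)" using ij by simp
  qed (use c in auto)
  hence "det Q * det Q = real N ^ N"
    using det_mult[OF c(2), of "transpose_mat Q"] det_transpose[OF c(2)] c by (simp add: det_smult)
  hence detQ: "det Q \<noteq> 0" using N0 by auto
  have "det Lm = prod_list (diag_mat Lm)"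
    by (rule det_lower_triangular[OF _ c(1)]) (auto simp: Lm_def L_upper)
  also have "\<dots> \<noteq> 0"
    unfolding prod_list_diag_prod by (auto simp: Lm_def L_diag)
  finally have "det M \<noteq> 0" unfolding M_def using det_mult[OF c(1,2)] detQ by simp
  then obtain B where B: "B \<in> carrier_mat N N" "M * B = 1\<^sub>m N" "B * M = 1\<^sub>m N"
    using inverse_mat_exists[OF c(3)] by blast

  \<comment> \<open>Below size 3 the recursion need not grow, so the right-hand side is put at the last such set.\<close>
  define p where "p = Max {i. i < N \<and> card (\<alpha> i) \<le> 2}"
  have fin_p: "finite {i. i < N \<and> card (\<alpha> i) \<le> 2}" by simp
  have "0 \<in> {i. i < N \<and> card (\<alpha> i) \<le> 2}" using N0 \<alpha>0 by simp
  hence "p \<in> {i. i < N \<and> card (\<alpha> i) \<le> 2}" using Max_in[OF fin_p] unfolding p_def by blast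
  hence p: "p < N" "card (\<alpha> p) \<le> 2" by auto
  have p_max: "3 \<le> card (\<alpha> i)" if "p < i" "i < N" for i
  proof (rule ccontr)
    assume "\<not> 3 \<le> card (\<alpha> i)"
    hence "i \<le> p" unfolding p_def using that by (intro Max_ge fin_p) auto
    thus False using that by simp
  qed
  \<comment> \<open>A singleton exists because \<open>V\<close> is nonempty. Positivity of
    \<open>p\<close> gives \<open>x 0 = 0\<close>, which removes the constant term from the
    recursion.\<close>
  have p_pos: "0 < p"
  proof -
    obtain v where "v \<in> V" using V by blast
    hence "{v} \<in> \<alpha> ` {..<N}" using bij by (auto simp: bij_betw_def)
    then obtain j where j: "j < N" "\<alpha> j = {v}" by fastforce
    have "j \<noteq> 0" using j(2) \<alpha>0 by (metis insert_not_empty)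
    moreover have "j \<le> p" unfolding p_def using j by (intro Max_ge fin_p) auto
    ultimately show ?thesis by simp
  qed
  \<comment> \<open>The value \<open>L p p\<close> normalises the solution to
    \<open>x p = 1\<close>.\<close>
  define b where "b i = (if i = p then L p p else 0)" for i
  define x where "x = forward_subst L b"
  have Lnz: "L i i \<noteq> 0" if "i < N" for i using L_diag[OF that] by auto
  have Lx: "(\<Sum>j<N. L i j * x j) = b i" if "i < N" for i
  proof -
    have "(\<Sum>j<N. L i j * x j) = (\<Sum>j\<le>i. L i j * x j)"
      using that by (intro sum.mono_neutral_right) (auto simp: L_upper)
    thus ?thesis unfolding x_def using forward_subst_solves[of L i b] Lnz[OF that] by simp
  qed
  have x0: "x i = 0" if "i < p" for i
    unfolding x_def by (rule forward_subst_eq_0) (use that in \<open>auto simp: b_def\<close>)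
  have xp: "x p = 1"
  proof -
    have "(\<Sum>j<p. L p j * x j) = 0" by (intro sum.neutral) (auto simp: x0)
    thus ?thesis using Lnz[OF p(1)] unfolding x_def
      by (subst forward_subst.simps) (simp add: b_def)
  qed
  \<comment> \<open>Nonnegativity and the bound on the sum of all earlier terms are carried along
    because they control the remaining indices of \<open>J i\<close>: the recursion reads
    \<open>x (Suc i) + x i + rest = 2 ^ (k - 1) * x i\<close>, with \<open>rest\<close> at most
    \<open>x i\<close>.\<close>
  have growth: "(\<forall>j\<le>i. 0 \<le> x j) \<and> (\<Sum>j<i. x j) \<le> x i \<and>
      2 powr (\<Sum>j\<in>{p<..i}. weight (card (\<alpha> j))) \<le> x i" if "p \<le> i" "i < N" for i
    using that
  proof (induction i rule: dec_induct)
    case base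
    have "(\<Sum>j<p. x j) = 0" by (intro sum.neutral) (auto simp: x0)
    moreover have "0 \<le> x j" if "j \<le> p" for j using that x0 xp by (cases "j = p") auto
    ultimately show ?case using xp by simp
  next
    case (step i)
    define k where "k = card (\<alpha> (Suc i))"
    have k: "3 \<le> k" unfolding k_def using step by (intro p_max) auto
    have i: "Suc i < N" "i < N" using step by auto
    have IH: "\<forall>j\<le>i. 0 \<le> x j" "(\<Sum>j<i. x j) \<le> x i"
      "2 powr (\<Sum>j\<in>{p<..i}. weight (card (\<alpha> j))) \<le> x i" using step i by auto
    have "b (Suc i) = 0" using step by (simp add: b_def)
    hence "(\<Sum>j\<in>J i. x j) / 2 ^ k = x i / 2"
      using Lx[OF i(1)] L_sum[OF i(1), of x] x0[OF p_pos] by (simp add: k_def)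
    hence "(\<Sum>j\<in>J i. x j) = 2 ^ k * (x i / 2)" by (simp add: field_simps)
    also have "\<dots> = 2 ^ (k - 1) * x i" using k by (cases k) auto
    finally have sumJ: "(\<Sum>j\<in>J i. x j) = 2 ^ (k - 1) * x i" .
    have "(\<Sum>j\<in>J i. x j) = x (Suc i) + (x i + (\<Sum>j\<in>J i - {Suc i} - {i}. x j))"
      using J[OF i(1)] by (simp add: sum.remove[of "J i" "Suc i"] sum.remove[of "J i - {Suc i}" i])
    moreover have "(\<Sum>j\<in>J i - {Suc i} - {i}. x j) \<le> (\<Sum>j<i. x j)"
    proof (intro sum_mono2)
      show "J i - {Suc i} - {i} \<subseteq> {..<i}" using J(3)[OF i(1)] by force
    qed (use IH in auto)
    ultimately have ge: "x (Suc i) \<ge> (2 ^ (k - 1) - 2) * x i"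
      using sumJ IH(2) by (simp add: algebra_simps)
    have xi: "0 \<le> x i" using IH by simp
    \<comment> \<open>From \<open>k \<ge> 3\<close> each step at least doubles, which is what keeps
      \<open>x (Suc i)\<close> above the sum of all its predecessors.\<close>
    have "(2::real) ^ 2 \<le> 2 ^ (k - 1)" using k by (intro power_increasing) auto
    hence four: "(2::real) \<le> 2 ^ (k - 1) - 2" by simp
    hence "2 * x i \<le> (2 ^ (k - 1) - 2) * x i" using xi by (intro mult_right_mono) auto
    hence two: "2 * x i \<le> x (Suc i)" using ge by linarith
    have "2 powr (\<Sum>j\<in>{p<..Suc i}. weight (card (\<alpha> j)))
        = 2 powr weight k * 2 powr (\<Sum>j\<in>{p<..i}. weight (card (\<alpha> j)))"
    proof -
      have "{p<..Suc i} = insert (Suc i) {p<..i}" using step by auto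
      thus ?thesis by (simp add: powr_add k_def)
    qed
    also have "\<dots> \<le> (2 ^ (k - 1) - 2) * x i"
      by (rule mult_mono) (use powr_weight_le[OF k] IH(3) four in auto)
    finally have "2 powr (\<Sum>j\<in>{p<..Suc i}. weight (card (\<alpha> j))) \<le> x (Suc i)" using ge by linarith
    moreover have "(\<Sum>j<Suc i. x j) \<le> x (Suc i)" using IH(2) two by simp
    moreover have "\<forall>j\<le>Suc i. 0 \<le> x j" using IH(1) xi two by (auto simp: le_Suc_eq)
    ultimately show ?case by blast
  qed

  \<comment> \<open>From the last coordinate of \<open>x\<close> to a large entry of the
    inverse\<close>
  define X where "X = x (N - 1)"
  have X: "2 powr (\<Sum>S\<in>Pow V. weight (card S)) \<le> X"
  proof -
    have "(\<Sum>S\<in>Pow V. weight (card S)) = (\<Sum>j<N. weight (card (\<alpha> j)))"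
      by (rule sum.reindex_bij_betw[OF bij, symmetric])
    also have "{..<N} = {..p} \<union> {p<..N - 1}" using p by auto
    also have "(\<Sum>j\<in>{..p} \<union> {p<..N - 1}. weight (card (\<alpha> j))) =
        (\<Sum>j\<le>p. weight (card (\<alpha> j))) + (\<Sum>j\<in>{p<..N - 1}. weight (card (\<alpha> j)))"
      by (intro sum.union_disjoint) auto
    also have "(\<Sum>j\<le>p. weight (card (\<alpha> j))) \<le> 0"
      using mono[OF _ p(1)] p(2) by (intro sum_nonpos weight_nonpos) (meson atMost_iff order_trans)
    finally have "2 powr (\<Sum>S\<in>Pow V. weight (card S)) \<le> 2 powr (\<Sum>j\<in>{p<..N - 1}. weight (card (\<alpha> j)))"
      by (intro powr_mono) auto
    also have "\<dots> \<le> X" unfolding X_def using growth[of "N - 1"] p(1) by simp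
    finally show ?thesis .
  qed
  have Xeq: "X = b p * (\<Sum>j<N. Q $$ (N - 1, j) * B $$ (j, p))"
  proof -
    define D where "D = Q * B"
    have D: "D \<in> carrier_mat N N" using c B by (simp add: D_def)
    have "Lm * D = 1\<^sub>m N" using B(2) assoc_mult_mat[OF c(1,2) B(1)] unfolding M_def D_def by simp
    hence inv: "D * Lm = 1\<^sub>m N" using mat_mult_left_right_inverse[OF c(1) D] by simp
    have Lmx: "Lm *\<^sub>v vec N x = vec N b"
    proof (rule eq_vecI)
      fix i assume "i < dim_vec (vec N b)"
      thus "(Lm *\<^sub>v vec N x) $ i = vec N b $ i"
        using Lx[of i] by (simp add: Lm_def scalar_prod_def atLeast0LessThan)
    qed (simp add: Lm_def)
    have "vec N x = D * Lm *\<^sub>v vec N x" unfolding inv by simp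
    also have "\<dots> = D *\<^sub>v vec N b"
      using assoc_mult_mat_vec[OF D c(1), of "vec N x"] Lmx by simp
    finally have "vec N x $ (N - 1) = (D *\<^sub>v vec N b) $ (N - 1)" by simp
    hence "X = (\<Sum>j<N. D $$ (N - 1, j) * b j)"
      using N0 D by (simp add: X_def scalar_prod_def atLeast0LessThan)
    also have "\<dots> = (\<Sum>j<N. if j = p then D $$ (N - 1, p) * b p else 0)"
      by (intro sum.cong) (auto simp: b_def)
    also have "\<dots> = b p * D $$ (N - 1, p)" using p by simp
    also have "D $$ (N - 1, p) = (\<Sum>j<N. Q $$ (N - 1, j) * B $$ (j, p))"
      using N0 p c B by (simp add: D_def scalar_prod_def atLeast0LessThan)
    finally show ?thesis .
  qed
  \<comment> \<open>Averaging: the entries of \<open>Q\<close> are signs and \<open>b p\<close> has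
    absolute value at most 1, so \<open>X\<close> is at most the sum of the \<open>N\<close>
    absolute values in column \<open>p\<close> of \<open>B\<close>.\<close>
  have "\<exists>j<N. X / real N \<le> \<bar>B $$ (j,p)\<bar>"
  proof (rule ccontr)
    assume "\<not> (\<exists>j<N. X / real N \<le> \<bar>B $$ (j,p)\<bar>)"
    hence *: "\<bar>B $$ (j,p)\<bar> < X / real N" if "j < N" for j using that by auto
    have "\<bar>b p\<bar> \<le> 1" using L_diag[OF p(1)] by (simp add: b_def abs_divide)
    hence "\<bar>X\<bar> \<le> \<bar>\<Sum>j<N. Q $$ (N - 1, j) * B $$ (j, p)\<bar>"
      unfolding Xeq abs_mult by (intro mult_left_le_one_le) auto
    also have "\<dots> \<le> (\<Sum>j<N. \<bar>Q $$ (N - 1, j) * B $$ (j, p)\<bar>)" by (rule sum_abs)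
    also have "\<dots> = (\<Sum>j<N. \<bar>B $$ (j, p)\<bar>)"
    proof (intro sum.cong refl)
      fix j assume "j \<in> {..<N}"
      thus "\<bar>Q $$ (N - 1, j) * B $$ (j, p)\<bar> = \<bar>B $$ (j, p)\<bar>"
        using walsh_cases[of "\<alpha> (N - 1)" "\<alpha> j"] by (auto simp: Q_def abs_mult)
    qed
    also have "\<dots> < (\<Sum>j<N. X / real N)" using * N0 by (intro sum_strict_mono) auto
    also have "\<dots> = X" using N0 by simp
    finally show False by simp
  qed
  then obtain j where j: "j < N" "X / real N \<le> \<bar>B $$ (j,p)\<bar>" by blast
  have "2 powr ((\<Sum>S\<in>Pow V. weight (card S)) - real (card V)) =
      2 powr (\<Sum>S\<in>Pow V. weight (card S)) / real N"
    by (simp add: powr_diff powr_realpow N_def)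
  also have "\<dots> \<le> X / real N" using X by (intro divide_right_mono) auto
  also note j(2)
  finally have "2 powr ((\<Sum>S\<in>Pow V. weight (card S)) - real (card V)) \<le> \<bar>B $$ (j,p)\<bar>" .
  thus ?thesis unfolding attains_def N_def[symmetric] using M01 B j p by blast
qed

text \<open>The loss of \<open>m\<close> is absorbed by Bernoulli's inequality,
  \<open>m \<le> 2 * (3 / 2) ^ m\<close>, which raises 16 to 18.\<close>

lemma attains_power_of_two:
  "attains (2 ^ m) (real m * 2 ^ m / 2 - 2 ^ m - 18 * (3 / 2) ^ m)"
proof (cases "m = 0")
  case True
  thus ?thesis using attains_mono[OF attains_0[of 1]] by simp
next
  case False
  have "1 + real m * (1 / 2) \<le> (1 + 1 / 2) ^ m" by (rule Bernoulli_inequality) simp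
  hence "real m \<le> 2 * (3 / 2) ^ m" by simp
  moreover have "attains (2 ^ m) (real m * 2 ^ m / 2 - 2 ^ m - 16 * (3 / 2) ^ m - real m)"
    using attains_layered[of "{..<m}"] False sum_weight_Pow[of "{..<m}"] by (simp add: lessThan_empty_iff)
  ultimately show ?thesis by (elim attains_mono) linarith
qed

subsection \<open>Arbitrary order\<close>

text \<open>The excess is \<open>a + r\<close> times the binary entropy of
  \<open>a / (a + r)\<close>, hence at most \<open>a + r \<le> 2 * a\<close>. The entropy bound
  comes from \<open>ln t \<le> t - 1\<close> at \<open>(a + r) / (2 * a)\<close> and
  \<open>(a + r) / (2 * r)\<close>.\<close>

lemma x_log_x_add_le:
  fixes a r :: real
  assumes "0 < r" "r \<le> a"
  shows "(a + r) * log 2 (a + r) \<le> a * log 2 a + r * log 2 r + 2 * a"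
proof -
  have a: "0 < a" using assms by simp
  have "ln ((a + r) / (2 * a)) \<le> (a + r) / (2 * a) - 1" using assms by (intro ln_le_minus_one) auto
  hence "a * ln ((a + r) / (2 * a)) \<le> a * ((a + r) / (2 * a) - 1)" using a by (intro mult_left_mono) auto
  also have "\<dots> = (r - a) / 2" using a by (simp add: field_simps)
  finally have 1: "a * (ln (a + r) - ln 2 - ln a) \<le> (r - a) / 2"
    using assms a by (simp add: ln_div ln_mult algebra_simps)
  have "ln ((a + r) / (2 * r)) \<le> (a + r) / (2 * r) - 1" using assms by (intro ln_le_minus_one) auto
  hence "r * ln ((a + r) / (2 * r)) \<le> r * ((a + r) / (2 * r) - 1)" using assms by (intro mult_left_mono) auto
  also have "\<dots> = (a - r) / 2" using assms by (simp add: field_simps)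
  finally have 2: "r * (ln (a + r) - ln 2 - ln r) \<le> (a - r) / 2"
    using assms a by (simp add: ln_div ln_mult algebra_simps)
  have "(a + r) * ln (a + r) \<le> a * ln a + r * ln r + (a + r) * ln 2"
    using 1 2 by (simp add: algebra_simps)
  also have "(a + r) * ln 2 \<le> (2 * a) * ln 2" using assms by (intro mult_right_mono) auto
  finally have "(a + r) * ln (a + r) / ln 2 \<le> (a * ln a + r * ln r + (2 * a) * ln 2) / ln 2"
    by (intro divide_right_mono) auto
  thus ?thesis by (simp add: log_def add_divide_distrib)
qed

text \<open>Induction on the binary length, splitting off the leading digit as
  \<open>n = 2 ^ m + r\<close>. By \<open>x_log_x_add_le\<close> gluing loses at most
  \<open>2 ^ m\<close>, doubling the loss \<open>2 ^ m\<close> of the power of two; hence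
  \<open>2 * n\<close> altogether. The constant 36 solves \<open>c * 3 / 2 = c + 18\<close>.\<close>

lemma attains_below_power_of_two:
  assumes "1 \<le> n" "n < 2 ^ m"
  shows "attains n (real n / 2 * log 2 n - 2 * real n - 36 * (3 / 2) ^ m)"
  using assms
proof (induction m arbitrary: n)
  case (Suc m)
  define c :: real where "c = (3 / 2) ^ m"
  have c: "0 < c" "(3 / 2) ^ Suc m = 3 / 2 * c" by (auto simp: c_def)
  have pow: "attains (2 ^ m) (real m * 2 ^ m / 2 - 2 ^ m - 18 * c)"
    unfolding c_def by (rule attains_power_of_two)
  have log_pow: "log 2 (2 ^ m) = real m" by (simp add: log_nat_power)
  consider "n < 2 ^ m" | "n = 2 ^ m" | "2 ^ m < n" by linarith
  thus ?case
  proof cases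
    case 1
    show ?thesis
      by (rule attains_mono[OF Suc.IH[OF Suc.prems(1) 1]]) (use c in \<open>auto simp: c_def[symmetric]\<close>)
  next
    case 2
    show ?thesis unfolding 2
      by (rule attains_mono[OF pow]) (use c log_pow in \<open>simp add: mult.commute\<close>)
  next
    case 3
    define r where "r = n - 2 ^ m"
    have r: "1 \<le> r" "r < 2 ^ m" "n = 2 ^ m + r" using 3 Suc.prems by (auto simp: r_def)
    have rr: "0 < real r" "real r \<le> 2 ^ m"
      using r by (auto simp: of_nat_less_numeral_power_cancel_iff intro: less_imp_le)
    have "real n * log 2 n \<le> 2 ^ m * real m + real r * log 2 r + 2 * 2 ^ m"
      using x_log_x_add_le[OF rr] log_pow r(3) by simp
    hence le: "real n / 2 * log 2 n - 2 * real n - 36 * (3 / 2) ^ Suc m \<le>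
        (real m * 2 ^ m / 2 - 2 ^ m - 18 * c) + (real r / 2 * log 2 r - 2 * real r - 36 * c)"
      unfolding c(2) using r(3) by (simp add: field_simps)
    have "attains (2 ^ m + r) ((real m * 2 ^ m / 2 - 2 ^ m - 18 * c) +
        (real r / 2 * log 2 r - 2 * real r - 36 * c))"
      using attains_add[OF pow Suc.IH[OF r(1,2)]] by (simp add: c_def)
    thus ?thesis using le attains_mono r(3) by blast
  qed
qed simp

text \<open>For the largest \<open>2 ^ m \<le> n\<close>, the number \<open>(3 / 2) ^ m\<close> is
  \<open>2 ^ m\<close> to the power \<open>log 2 (3 / 2)\<close>. The 54 is
  \<open>36 * 3 / 2\<close>, as the preceding bound is taken at \<open>Suc m\<close>.\<close>

lemma chi_lower_bound:
  assumes "n \<ge> 1"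
  shows "real n powr (real n / 2) / 2 powr (2 * real n + 54 * real n powr log 2 (3 / 2)) \<le> chi n"
proof -
  obtain m where m: "2 ^ m \<le> n" "n < 2 ^ Suc m"
    using ex_power_ivl1[of 2 n] assms by auto
  have "(3 / 2 :: real) ^ m = (2 powr log 2 (3 / 2)) powr real m" by (simp add: powr_realpow)
  also have "\<dots> = (2 ^ m) powr log 2 (3 / 2)"
    by (simp only: powr_powr powr_realpow[symmetric] zero_less_numeral) (simp add: powr_powr mult.commute)
  also have "\<dots> \<le> real n powr log 2 (3 / 2)"
  proof (rule powr_mono2)
    show "2 ^ m \<le> real n" using m(1) by (metis of_nat_le_iff of_nat_numeral of_nat_power)
  qed (auto simp: zero_le_log_cancel_iff)
  finally have "attains n (real n / 2 * log 2 n - (2 * real n + 54 * real n powr log 2 (3 / 2)))"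
    by (intro attains_mono[OF attains_below_power_of_two[OF assms m(2)]]) simp
  hence "2 powr (real n / 2 * log 2 n - (2 * real n + 54 * real n powr log 2 (3 / 2))) \<le> chi n"
    by (rule attains_le_chi)
  moreover have "2 powr (real n / 2 * log 2 n) = real n powr (real n / 2)"
    using assms by (simp add: powr_def log_def)
  ultimately show ?thesis by (simp add: powr_diff)
qed

theorem mainTheorem16:
  "\<exists>g :: nat \<Rightarrow> real. g \<in> o(\<lambda>n. real n) \<and>
     (\<forall>n::nat. n \<ge> 2 \<longrightarrow>
        real n powr (real n / 2) / 2 powr (2 * real n + g n) \<le> chi n \<and>
        chi n \<le> rho (n - 1) \<and>
        rho (n - 1) \<le> real n powr (real n / 2) / 2 ^ (n - 1))"
proof (intro exI conjI allI impI)
  \<comment> \<open>The witness for \<open>g\<close> is the error term of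
    \<open>chi_lower_bound\<close>; it is sublinear because \<open>3 / 2 < 2\<close> makes the
    exponent \<open>?a\<close> less than 1.\<close>
  let ?a = "log 2 (3 / 2) :: real"
  have "?a < 1" by (simp add: log_less_iff)
  hence "((\<lambda>x::real. x powr (?a - 1)) \<longlongrightarrow> 0) at_top" by (intro tendsto_neg_powr filterlim_ident) simp
  hence "((\<lambda>n. real n powr (?a - 1)) \<longlongrightarrow> 0) sequentially"
    by (rule filterlim_compose[OF _ filterlim_real_sequentially])
  hence "((\<lambda>n. real n powr ?a / real n) \<longlongrightarrow> 0) sequentially"
    by (rule Lim_transform_eventually) (auto simp: powr_diff intro!: eventually_sequentiallyI[of 1])
  hence "(\<lambda>n. real n powr ?a) \<in> o(\<lambda>n. real n)"
    by (intro smalloI_tendsto) (auto intro!: eventually_sequentiallyI[of 1])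
  thus "(\<lambda>n. 54 * real n powr ?a) \<in> o(\<lambda>n. real n)" by simp
qed (use chi_lower_bound chi_le_rho rho_le in auto)

end
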